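(* Let $p$ be a prime and $n\ge 1$. For $\boldsymbol{m}=(m_1,\ldots,m_n)\in\mathbb{Z}_{\ge 0}^n$ and $\boldsymbol{x}=(x_1,\ldots,x_n)\in\mathbb{Z}_p^n$ put $$E_{\boldsymbol{m}}(\boldsymbol{x})=e_{m_1}(x_1)\cdots e_{m_n}(x_n).$$ Then the functions $E_{\boldsymbol{m}}$, $\boldsymbol{m}\in\mathbb{Z}_{\ge 0}^n$, form an orthonormal basis (the van der Put basis) of the space $C(\mathbb{Z}_p^n\to\mathbb{Q}_p)$. Moreover, if $F:\mathbb{Z}_p^n\to\mathbb{Q}_p$ is continuous and has the expansion $$F(\boldsymbol{x})=\sum_{\boldsymbol{m}\in\mathbb{Z}_{\ge 0}^n}A_{\boldsymbol{m}}E_{\boldsymbol{m}}(\boldsymbol{x})=\sum_{m_1\ge 0}\cdots\sum_{m_n\ge 0}A_{m_1,\ldots,m_n}\,e_{m_1}(x_1)\cdots e_{m_n}(x_n),$$ then $A_{m_1,\ldots,m_n}=F(m_1,\ldots,m_n)$ when $m_i<p$ for every $i=1,\ldots,n$; and otherwise, with $I(\boldsymbol{m})=\{i_1,\ldots,i_k\}$ the (nonempty) set of indices $i$ with $m_i\ge p$, $$A_{m_1,\ldots,m_n}=\phi_k(\ldots,\widehat{m}_{i_k},\ldots),$$ where $\phi_k$ is the iterated difference of $F$ at $\boldsymbol{m}$ defined in the context.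
   Context: $C(\mathbb{Z}_p^n\to\mathbb{Q}_p)$ is the $\mathbb{Q}_p$-Banach space of continuous functions $F:\mathbb{Z}_p^n\to\mathbb{Q}_p$ with norm $\|F\|_\infty=\sup_{\boldsymbol{x}\in\mathbb{Z}_p^n}|F(\boldsymbol{x})|_p$. Orthonormal basis is meant in the non-Archimedean sense: every $F$ in the space can be written uniquely as a sum $F=\sum_{\boldsymbol{m}}A_{\boldsymbol{m}}E_{\boldsymbol{m}}$ converging in $\|\cdot\|_\infty$, with $A_{\boldsymbol{m}}\in\mathbb{Q}_p$, and $\|F\|_\infty=\sup_{\boldsymbol{m}}|A_{\boldsymbol{m}}|_p$. One-variable functions: write $x\in\mathbb{Z}_p$ as $x=\sum_{i\ge0}x_ip^i$ with $x_i\in\{0,\ldots,p-1\}$. For $m\in\mathbb{Z}_{\ge0}$ write $m\vartriangleleft x$ ($m$ is an initial part of $x$) if $m$ is one of the numbers $x_0+x_1p+\cdots+x_Np^N$, $N\ge0$. Let $e_m(x)=1$ if $m\vartriangleleft x$ and $e_m(x)=0$ otherwise. For an integer $m\ge p$ with $m=m_0+m_1p+\cdots+m_sp^s$ (base-$p$ digits, $m_s\ne0$, so $s=\lfloor\log_p m\rfloor\ge1$) put $m^\ast=m_0+m_1p+\cdots+m_{s-1}p^{s-1}$. Iterated differences: for $\boldsymbol{m}\in\mathbb{Z}_{\ge0}^n$ let $I(\boldsymbol{m})=\{i_1,\ldots,i_k\}$ be the set of indices $i\in\{1,\ldots,n\}$ with $m_i\ge p$. For $F:\mathbb{Z}_p^n\to\mathbb{Q}_p$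 define $$\phi_1(m_1,\ldots,\widehat{m}_{i_1},\ldots,m_n)=F(m_1,\ldots,m_{i_1},\ldots,m_n)-F(m_1,\ldots,m_{i_1}^\ast,\ldots,m_n),$$ and recursively, for $2\le l\le k$, $$\phi_l(\ldots,\widehat{m}_{i_l},\ldots)=\phi_{l-1}(\ldots,m_{i_l},\ldots)-\phi_{l-1}(\ldots,m_{i_l}^\ast,\ldots),$$ where in $\phi_l$ the entries $m_{i_1},\ldots,m_{i_l}$ (marked with hats) are fixed and all other entries remain as variables. For example, $\phi_2=F(\ldots,m_{i_1},\ldots,m_{i_2},\ldots)-F(\ldots,m_{i_1}^\ast,\ldots,m_{i_2},\ldots)-[F(\ldots,m_{i_1},\ldots,m_{i_2}^\ast,\ldots)-F(\ldots,m_{i_1}^\ast,\ldots,m_{i_2}^\ast,\ldots)]$. *)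

theory Defs
  imports "HOL-Analysis.Analysis" "HOL-Number_Theory.Number_Theory"
    "HOL-Computational_Algebra.Squarefree" "Berlekamp_Zassenhaus.Finite_Field"
begin

section \<open>The field of $p$-adic numbers\<close>

text \<open>
  The prime $p$ is the cardinality of a type \<open>'p\<close> of class \<open>prime_card\<close>.  The type
  \<open>'p padic\<close> is the completion of the rationals with respect to the $p$-adic absolute value:
  Cauchy sequences modulo null sequences, along the lines of the construction of \<^typ>\<open>real\<close>.
\<close>

subsection \<open>The $p$-adic absolute value on the rationals\<close>

definition pabs :: "nat \<Rightarrow> rat \<Rightarrow> real" where
  "pabs p x = (if x = 0 then 0
     else (case quotient_of x of (a, b) \<Rightarrow>
       real p powi (int (multiplicity (int p) b) - int (multiplicity (int p) a))))"

lemma pabs_0 [simp]: "pabs p 0 = 0"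
  by (simp add: pabs_def)

lemma pabs_frac:
  assumes p: "prime p" and a: "a \<noteq> 0" and n: "n \<noteq> 0"
  shows "pabs p (of_int a / of_int n) =
    real p powi (int (multiplicity (int p) n) - int (multiplicity (int p) a))"
proof -
  obtain c d where q: "quotient_of (of_int a / of_int n) = (c, d)"
    by (cases "quotient_of (of_int a / of_int n)") auto
  have d: "d > 0" using quotient_of_denom_pos[OF q] .
  have eq: "(of_int a / of_int n :: rat) = of_int c / of_int d"
    using quotient_of_div[OF q] .
  then have "(of_int (a * d) :: rat) = of_int (c * n)"
    using d n by (simp add: field_simps)
  then have e: "a * d = c * n"
    using of_int_eq_iff by blast
  then have c: "c \<noteq> 0" using a d n by auto
  have pp: "prime_elem (int p)" using p by auto
  have "multiplicity (int p) a + multiplicity (int p) d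
      = multiplicity (int p) c + multiplicity (int p) n"
    using arg_cong[OF e, of "multiplicity (int p)"] a c d n
    by (simp add: prime_elem_multiplicity_mult_distrib[OF pp])
  then have "int (multiplicity (int p) d) - int (multiplicity (int p) c)
      = int (multiplicity (int p) n) - int (multiplicity (int p) a)"
    by linarith
  then show ?thesis using a n by (simp add: pabs_def q)
qed

lemma rat_common_denom:
  obtains a b n where "n \<noteq> 0" "(x::rat) = of_int a / of_int n" "(y::rat) = of_int b / of_int n"
proof -
  obtain a m where q: "quotient_of x = (a, m)" by (cases "quotient_of x") auto
  obtain b k where r: "quotient_of y = (b, k)" by (cases "quotient_of y") auto
  have mk: "m > 0" "k > 0" using quotient_of_denom_pos q r by blast+
  show thesis
    using mk quotient_of_div[OF q] quotient_of_div[OF r]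
    by (intro that[of "m * k" "a * k" "b * m"]) (auto simp: field_simps)
qed

lemma pabs_nonneg [simp]: "pabs p x \<ge> 0"
  by (auto simp: pabs_def split: prod.split)

lemma pabs_eq_0 [simp]: "prime p \<Longrightarrow> pabs p x = 0 \<longleftrightarrow> x = 0"
  by (auto simp: pabs_def prime_gt_0_nat split: prod.split)

lemma pabs_minus [simp]: "prime p \<Longrightarrow> pabs p (- x) = pabs p x"
  by (auto simp: pabs_def rat_uminus_code Let_def split: prod.split)

lemma pabs_minus_commute: "prime p \<Longrightarrow> pabs p (x - y) = pabs p (y - x)"
  using pabs_minus[of p "x - y"] by simp

lemma pabs_1 [simp]: "pabs p 1 = 1"
  by (simp add: pabs_def)

lemma pabs_mult:
  assumes p: "prime p"
  shows "pabs p (x * y) = pabs p x * pabs p y"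
proof (cases "x = 0 \<or> y = 0")
  case False
  obtain a b n where n: "n \<noteq> 0" and x: "x = of_int a / of_int n" and y: "y = of_int b / of_int n"
    by (rule rat_common_denom)
  have ab: "a \<noteq> 0" "b \<noteq> 0" using False x y by auto
  have pp: "prime_elem (int p)" using p by auto
  have xy: "x * y = of_int (a * b) / of_int (n * n)" by (simp add: x y)
  show ?thesis
    unfolding xy unfolding x y
    using p prime_gt_0_nat[OF p] ab n
    by (simp add: pabs_frac prime_elem_multiplicity_mult_distrib[OF pp] del: of_int_mult
        flip: power_int_add) (simp add: algebra_simps)
qed auto

lemma pabs_add:
  assumes p: "prime p"
  shows "pabs p (x + y) \<le> max (pabs p x) (pabs p y)"
proof (cases "x = 0 \<or> y = 0 \<or> x + y = 0")
  case False
  obtain a b n where n: "n \<noteq> 0" and x: "x = of_int a / of_int n" and y: "y = of_int b / of_int n"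
    by (rule rat_common_denom)
  have xy: "x + y = of_int (a + b) / of_int n" by (simp add: x y add_divide_distrib)
  have nz: "a \<noteq> 0" "b \<noteq> 0" "a + b \<noteq> 0" using False x y xy by auto
  let ?v = "multiplicity (int p)"
  have "int p ^ min (?v a) (?v b) dvd a + b"
    by (intro dvd_add) (auto intro!: multiplicity_dvd')
  then have v: "min (?v a) (?v b) \<le> ?v (a + b)"
    using p nz by (intro multiplicity_geI) (auto simp: prime_gt_1_nat)
  have p1: "real p \<ge> 1" using prime_ge_1_nat[OF p] by simp
  have mono: "real p powi (int (?v n) - int (?v (a + b))) \<le> real p powi (int (?v n) - int (?v c))"
    if "?v c \<le> ?v (a + b)" for c
    using that p1 by (intro power_int_increasing) auto
  show ?thesis
    unfolding xy unfolding x y pabs_frac[OF p nz(1) n] pabs_frac[OF p nz(2) n] pabs_frac[OF p nz(3) n]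
    using v mono[of a] mono[of b] by (auto simp: min_def max_def split: if_splits)
qed (use p in \<open>auto simp: add_eq_0_iff\<close>)

lemma pabs_triangle: "prime p \<Longrightarrow> pabs p (x + y) \<le> pabs p x + pabs p y"
  using pabs_add[of p x y] pabs_nonneg[of p x] pabs_nonneg[of p y] by linarith

lemma pabs_diff_triangle:
  assumes "prime p"
  shows "\<bar>pabs p x - pabs p y\<bar> \<le> pabs p (x - y)"
  using pabs_triangle[OF assms, of "x - y" y] pabs_triangle[OF assms, of "y - x" x]
    pabs_minus_commute[OF assms, of x y] by simp

lemma pabs_inverse:
  assumes "prime p"
  shows "pabs p (inverse x) = inverse (pabs p x)"
proof (cases "x = 0")
  case False
  then have "pabs p (inverse x) * pabs p x = 1"
    by (simp flip: pabs_mult[OF assms])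
  then show ?thesis
    by (metis inverse_unique mult.commute)
qed simp


subsection \<open>Cauchy sequences and null sequences\<close>

definition pnull :: "nat \<Rightarrow> (nat \<Rightarrow> rat) \<Rightarrow> bool" where
  "pnull p X \<longleftrightarrow> (\<lambda>n. pabs p (X n)) \<longlonglongrightarrow> 0"

definition pcauchy :: "nat \<Rightarrow> (nat \<Rightarrow> rat) \<Rightarrow> bool" where
  "pcauchy p X \<longleftrightarrow> (\<forall>e>0. \<exists>k. \<forall>m\<ge>k. \<forall>n\<ge>k. pabs p (X m - X n) < e)"

context
  fixes p :: nat
  assumes p: "prime p"
begin

lemma pnull_le:
  assumes "pnull p Y" "\<And>n. pabs p (X n) \<le> pabs p (Y n)"
  shows "pnull p X"
  unfolding pnull_def
  by (rule tendsto_sandwich[OF _ _ tendsto_const assms(1)[unfolded pnull_def]]) (auto simp: assms(2))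

lemma pnull_0: "pnull p (\<lambda>n. 0)"
  by (simp add: pnull_def)

lemma pnull_minus: "pnull p X \<Longrightarrow> pnull p (\<lambda>n. - X n)"
  by (simp add: pnull_def p)

lemma pnull_add:
  assumes "pnull p X" "pnull p Y"
  shows "pnull p (\<lambda>n. X n + Y n)"
proof -
  have "(\<lambda>n. pabs p (X n) + pabs p (Y n)) \<longlonglongrightarrow> 0"
    using tendsto_add[OF assms[unfolded pnull_def]] by simp
  then show ?thesis
    unfolding pnull_def
    by (rule tendsto_sandwich[OF _ _ tendsto_const, rotated 2]) (auto simp: pabs_triangle p)
qed

lemma pcauchy_const: "pcauchy p (\<lambda>n. c)"
  by (simp add: pcauchy_def)

lemma pcauchy_minus: "pcauchy p X \<Longrightarrow> pcauchy p (\<lambda>n. - X n)"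
  using pabs_minus_commute[OF p] by (simp add: pcauchy_def)

lemma pcauchy_add:
  assumes "pcauchy p X" "pcauchy p Y"
  shows "pcauchy p (\<lambda>n. X n + Y n)"
  unfolding pcauchy_def
proof (intro allI impI)
  fix e :: real assume e: "e > 0"
  obtain k where k: "\<And>m n. m \<ge> k \<Longrightarrow> n \<ge> k \<Longrightarrow> pabs p (X m - X n) < e"
    using assms(1) e unfolding pcauchy_def by blast
  obtain l where l: "\<And>m n. m \<ge> l \<Longrightarrow> n \<ge> l \<Longrightarrow> pabs p (Y m - Y n) < e"
    using assms(2) e unfolding pcauchy_def by blast
  have "pabs p (X m + Y m - (X n + Y n)) < e" if "m \<ge> max k l" "n \<ge> max k l" for m n
    using pabs_add[OF p, of "X m - X n" "Y m - Y n"] k[of m n] l[of m n] that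
    by (simp add: algebra_simps)
  then show "\<exists>k. \<forall>m\<ge>k. \<forall>n\<ge>k. pabs p (X m + Y m - (X n + Y n)) < e" by blast
qed

lemma pcauchy_Cauchy:
  assumes "pcauchy p X"
  shows "Cauchy (\<lambda>n. pabs p (X n))"
  unfolding Cauchy_def dist_real_def
  using assms pabs_diff_triangle[OF p] unfolding pcauchy_def by (meson le_less_trans)

lemma pcauchy_convergent: "pcauchy p X \<Longrightarrow> convergent (\<lambda>n. pabs p (X n))"
  by (simp add: pcauchy_Cauchy Cauchy_convergent)

lemma pcauchy_bounded:
  assumes "pcauchy p X"
  obtains B where "B > 0" "\<And>n. pabs p (X n) \<le> B"
  using convergent_imp_Bseq[OF pcauchy_convergent[OF assms]] by (auto simp: Bseq_def)

lemma pcauchy_mult: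
  assumes "pcauchy p X" "pcauchy p Y"
  shows "pcauchy p (\<lambda>n. X n * Y n)"
  unfolding pcauchy_def
proof (intro allI impI)
  fix e :: real assume e: "e > 0"
  obtain A where A: "A > 0" "\<And>n. pabs p (X n) \<le> A"
    by (rule pcauchy_bounded[OF assms(1)]) blast
  obtain B where B: "B > 0" "\<And>n. pabs p (Y n) \<le> B"
    by (rule pcauchy_bounded[OF assms(2)]) blast
  obtain k where k: "\<And>m n. m \<ge> k \<Longrightarrow> n \<ge> k \<Longrightarrow> pabs p (X m - X n) < e / B"
    using assms(1) e B(1) unfolding pcauchy_def by (meson divide_pos_pos)
  obtain l where l: "\<And>m n. m \<ge> l \<Longrightarrow> n \<ge> l \<Longrightarrow> pabs p (Y m - Y n) < e / A"
    using assms(2) e A(1) unfolding pcauchy_def by (meson divide_pos_pos)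
  have "pabs p (X m * Y m - X n * Y n) < e" if "m \<ge> max k l" "n \<ge> max k l" for m n
  proof -
    have 1: "pabs p (X m * (Y m - Y n)) < e"
    proof -
      have "pabs p (X m * (Y m - Y n)) \<le> A * pabs p (Y m - Y n)"
        by (simp add: pabs_mult[OF p] mult_right_mono A(2))
      also have "\<dots> < e" using l[of m n] that A(1) by (simp add: field_simps)
      finally show ?thesis .
    qed
    have 2: "pabs p ((X m - X n) * Y n) < e"
    proof -
      have "pabs p ((X m - X n) * Y n) \<le> pabs p (X m - X n) * B"
        by (simp add: pabs_mult[OF p] mult_left_mono B(2))
      also have "\<dots> < e" using k[of m n] that B(1) by (simp add: field_simps)
      finally show ?thesis .
    qed
    show ?thesis
      using pabs_add[OF p, of "X m * (Y m - Y n)" "(X m - X n) * Y n"] 1 2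
      by (simp add: algebra_simps)
  qed
  then show "\<exists>k. \<forall>m\<ge>k. \<forall>n\<ge>k. pabs p (X m * Y m - X n * Y n) < e" by blast
qed

lemma pnull_mult:
  assumes "pnull p X" "pcauchy p Y"
  shows "pnull p (\<lambda>n. X n * Y n)"
proof -
  obtain B where B: "B > 0" "\<And>n. pabs p (Y n) \<le> B"
    by (rule pcauchy_bounded[OF assms(2)]) blast
  have "(\<lambda>n. pabs p (X n) * B) \<longlonglongrightarrow> 0"
    using tendsto_mult_right[OF assms(1)[unfolded pnull_def], of B] by simp
  then show ?thesis
    unfolding pnull_def
    by (rule tendsto_sandwich[OF _ _ tendsto_const, rotated 2])
      (auto simp: pabs_mult p mult_left_mono B)
qed

lemma pcauchy_not_null:
  assumes X: "pcauchy p X" and nz: "\<not> pnull p X"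
  obtains b k where "b > 0" "\<And>n. n \<ge> k \<Longrightarrow> pabs p (X n) > b"
proof -
  obtain L where L: "(\<lambda>n. pabs p (X n)) \<longlonglongrightarrow> L"
    using pcauchy_convergent[OF X] by (auto simp: convergent_def)
  have "L \<ge> 0" by (rule LIMSEQ_le_const[OF L]) simp
  moreover have "L \<noteq> 0" using nz L by (auto simp: pnull_def)
  ultimately have "L / 2 > 0" "L / 2 < L" by auto
  moreover from order_tendstoD(1)[OF L this(2)]
  obtain k where "\<And>n. n \<ge> k \<Longrightarrow> pabs p (X n) > L / 2"
    by (auto simp: eventually_sequentially)
  ultimately show thesis using that by blast
qed

lemma pabs_inverse_diff:
  assumes "x \<noteq> 0" "y \<noteq> 0"
  shows "pabs p (inverse x - inverse y) = pabs p (x - y) / (pabs p x * pabs p y)"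
proof -
  have "inverse x - inverse y = (y - x) * (inverse x * inverse y)"
    using assms by (simp add: field_simps)
  then have "pabs p (inverse x - inverse y)
      = pabs p (x - y) * (inverse (pabs p x) * inverse (pabs p y))"
    by (simp only: pabs_mult[OF p] pabs_inverse[OF p] pabs_minus_commute[OF p, of y])
  then show ?thesis by (simp add: divide_inverse)
qed

lemma pcauchy_inverse:
  assumes X: "pcauchy p X" and nz: "\<not> pnull p X"
  shows "pcauchy p (\<lambda>n. inverse (X n))"
  unfolding pcauchy_def
proof (intro allI impI)
  fix e :: real assume e: "e > 0"
  obtain b k where b: "b > 0" and k: "\<And>n. n \<ge> k \<Longrightarrow> pabs p (X n) > b"
    by (rule pcauchy_not_null[OF X nz]) blast
  obtain l where l: "\<And>m n. m \<ge> l \<Longrightarrow> n \<ge> l \<Longrightarrow> pabs p (X m - X n) < e * (b * b)"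
    using X e b unfolding pcauchy_def by (meson mult_pos_pos)
  have "pabs p (inverse (X m) - inverse (X n)) < e" if mn: "m \<ge> max k l" "n \<ge> max k l" for m n
  proof -
    have bb: "b < pabs p (X m)" "b < pabs p (X n)" using k mn by auto
    then have nz: "X m \<noteq> 0" "X n \<noteq> 0" using b by auto
    have "pabs p (inverse (X m) - inverse (X n)) \<le> pabs p (X m - X n) / (b * b)"
      unfolding pabs_inverse_diff[OF nz]
      using bb b by (intro divide_left_mono mult_mono mult_pos_pos) auto
    also have "\<dots> < e" using l[of m n] mn b by (simp add: field_simps)
    finally show ?thesis .
  qed
  then show "\<exists>k. \<forall>m\<ge>k. \<forall>n\<ge>k. pabs p (inverse (X m) - inverse (X n)) < e" by blast
qed

end

definition padic_rel :: "nat \<Rightarrow> (nat \<Rightarrow> rat) \<Rightarrow> (nat \<Rightarrow> rat) \<Rightarrow> bool" where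
  "padic_rel p X Y \<longleftrightarrow> pcauchy p X \<and> pcauchy p Y \<and> pnull p (\<lambda>n. X n - Y n)"

lemma padic_rel_refl: "prime p \<Longrightarrow> pcauchy p X \<Longrightarrow> padic_rel p X X"
  by (simp add: padic_rel_def pnull_0)

lemma part_equivp_padic_rel:
  assumes p: "prime p"
  shows "part_equivp (padic_rel p)"
proof (rule part_equivpI)
  show "\<exists>X. padic_rel p X X"
    using padic_rel_refl[OF p] pcauchy_const[OF p] by blast
  show "symp (padic_rel p)"
    using pabs_minus_commute[OF p] by (auto simp: symp_def padic_rel_def pnull_def)
  show "transp (padic_rel p)"
  proof (rule transpI)
    fix X Y Z assume "padic_rel p X Y" "padic_rel p Y Z"
    then show "padic_rel p X Z"
      using pnull_add[OF p, of "\<lambda>n. X n - Y n" "\<lambda>n. Y n - Z n"] by (auto simp: padic_rel_def)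
  qed
qed

lemma padic_rel_limit:
  assumes p: "prime p" and XY: "padic_rel p X Y"
  shows "lim (\<lambda>n. pabs p (X n)) = lim (\<lambda>n. pabs p (Y n))"
proof -
  have X: "pcauchy p X" and Y: "pcauchy p Y" and Z: "pnull p (\<lambda>n. X n - Y n)"
    using XY by (auto simp: padic_rel_def)
  obtain L where L: "(\<lambda>n. pabs p (X n)) \<longlonglongrightarrow> L"
    using pcauchy_convergent[OF p X] by (auto simp: convergent_def)
  have "(\<lambda>n. pabs p (X n) - pabs p (Y n)) \<longlonglongrightarrow> 0"
    by (rule Lim_null_comparison[OF _ Z[unfolded pnull_def]])
      (simp add: pabs_diff_triangle[OF p])
  from tendsto_diff[OF L this] have "(\<lambda>n. pabs p (Y n)) \<longlonglongrightarrow> L" by simp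
  with L show ?thesis by (metis limI)
qed


subsection \<open>The type of $p$-adic numbers\<close>

text \<open>This is the effect of \<open>quotient_type\<close>, which does not accept the sort constraint on \<open>'p\<close>.\<close>

typedef ('p::prime_card) padic =
    "{C. \<exists>X. padic_rel CARD('p) X X \<and> C = Collect (padic_rel CARD('p) X)}"
  using padic_rel_refl[OF prime_card pcauchy_const[OF prime_card]] by blast

interpretation padic: quot_type "padic_rel CARD('p::prime_card)" Abs_padic
    "Rep_padic :: 'p padic \<Rightarrow> (nat \<Rightarrow> rat) set"
proof
  show "part_equivp (padic_rel CARD('p))"
    by (rule part_equivp_padic_rel[OF prime_card])
  fix y :: "'p padic" and c
  show "\<exists>x. padic_rel CARD('p) x x \<and> Rep_padic y = Collect (padic_rel CARD('p) x)"
    using Rep_padic[of y] by blast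
  show "Abs_padic (Rep_padic y) = y"
    by (rule Rep_padic_inverse)
  show "Rep_padic (Abs_padic c :: 'p padic) = c"
    if "\<exists>x. padic_rel CARD('p) x x \<and> c = Collect (padic_rel CARD('p) x)"
    using that by (intro Abs_padic_inverse) blast
  show "(Rep_padic x = Rep_padic y) = (x = y)" for x y :: "'p padic"
    by (rule Rep_padic_inject)
qed

definition cr_padic :: "(nat \<Rightarrow> rat) \<Rightarrow> 'p::prime_card padic \<Rightarrow> bool" where
  "cr_padic = (\<lambda>X x. padic_rel CARD('p) X X \<and> padic.abs X = x)"

lemma Quotient_padic:
  "Quotient (padic_rel CARD('p)) padic.abs padic.rep
    (cr_padic :: (nat \<Rightarrow> rat) \<Rightarrow> 'p::prime_card padic \<Rightarrow> bool)"
  by (rule Quotient3_to_Quotient[OF padic.Quotient]) (simp add: cr_padic_def)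

setup_lifting Quotient_padic

instantiation padic :: (prime_card) field
begin

lift_definition zero_padic :: "'a padic" is "\<lambda>n. 0"
  by (simp add: padic_rel_refl prime_card pcauchy_const)

lift_definition one_padic :: "'a padic" is "\<lambda>n. 1"
  by (simp add: padic_rel_refl prime_card pcauchy_const)

lift_definition plus_padic :: "'a padic \<Rightarrow> 'a padic \<Rightarrow> 'a padic" is "\<lambda>X Y n. X n + Y n"
  subgoal for X X' Y Y'
    using pnull_add[of "CARD('a)" "\<lambda>n. X n - X' n" "\<lambda>n. Y n - Y' n"]
    by (auto simp: padic_rel_def prime_card pcauchy_add algebra_simps)
  done

lift_definition uminus_padic :: "'a padic \<Rightarrow> 'a padic" is "\<lambda>X n. - X n"
  subgoal for X Y
    using pnull_minus[of "CARD('a)" "\<lambda>n. X n - Y n"]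
    by (auto simp: padic_rel_def prime_card pcauchy_minus)
  done

lift_definition times_padic :: "'a padic \<Rightarrow> 'a padic \<Rightarrow> 'a padic" is "\<lambda>X Y n. X n * Y n"
  subgoal for X X' Y Y'
    using pnull_add[OF prime_card, OF
        pnull_mult[OF prime_card, of "\<lambda>n. X n - X' n" Y]
        pnull_mult[OF prime_card, of "\<lambda>n. Y n - Y' n" X']]
    by (auto simp: padic_rel_def prime_card pcauchy_mult algebra_simps)
  done

lift_definition inverse_padic :: "'a padic \<Rightarrow> 'a padic"
  is "\<lambda>X. if pnull CARD('a) X then (\<lambda>n. 0) else (\<lambda>n. inverse (X n))"
proof -
  fix X Y :: "nat \<Rightarrow> rat"
  let ?p = "CARD('a)"
  note p = prime_card[where 'a = 'a]
  assume "padic_rel ?p X Y"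
  then have X: "pcauchy ?p X" and Y: "pcauchy ?p Y" and XY: "pnull ?p (\<lambda>n. X n - Y n)"
    by (auto simp: padic_rel_def)
  have iff: "pnull ?p X \<longleftrightarrow> pnull ?p Y"
    using pnull_add[OF p, of "\<lambda>n. X n - Y n" Y] pnull_add[OF p, of "\<lambda>n. -(X n - Y n)" X]
      pnull_minus[OF p XY] XY by auto
  show "padic_rel ?p (if pnull ?p X then \<lambda>n. 0 else (\<lambda>n. inverse (X n)))
     (if pnull ?p Y then \<lambda>n. 0 else (\<lambda>n. inverse (Y n)))"
  proof (cases "pnull ?p X")
    case True
    then show ?thesis using iff by (simp add: padic_rel_refl[OF p] pcauchy_const[OF p])
  next
    case False
    then have nY: "\<not> pnull ?p Y" using iff by simp
    note iX = pcauchy_inverse[OF p X False] and iY = pcauchy_inverse[OF p Y nY]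
    obtain b k where k: "b > 0" "\<And>n. n \<ge> k \<Longrightarrow> pabs ?p (X n) > b"
      by (rule pcauchy_not_null[OF p X False]) blast
    obtain c l where l: "c > 0" "\<And>n. n \<ge> l \<Longrightarrow> pabs ?p (Y n) > c"
      by (rule pcauchy_not_null[OF p Y nY]) blast
    have ev: "(Y n - X n) * (inverse (X n) * inverse (Y n)) = inverse (X n) - inverse (Y n)"
      if "n \<ge> max k l" for n
    proof -
      have "X n \<noteq> 0" "Y n \<noteq> 0" using k(1) k(2)[of n] l(1) l(2)[of n] that by auto
      then show ?thesis by (simp add: field_simps)
    qed
    have "pnull ?p (\<lambda>n. (Y n - X n) * (inverse (X n) * inverse (Y n)))"
      using pnull_mult[OF p pnull_minus[OF p XY] pcauchy_mult[OF p iX iY]] by simp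
    then have "pnull ?p (\<lambda>n. inverse (X n) - inverse (Y n))"
      unfolding pnull_def
      by (rule Lim_transform_eventually)
        (use ev in \<open>auto simp: eventually_sequentially intro!: exI[of _ "max k l"]\<close>)
    then show ?thesis using False nY iX iY by (simp add: padic_rel_def)
  qed
qed

definition "x - y = x + - y" for x y :: "'a padic"

definition "x div y = x * inverse y" for x y :: "'a padic"

instance
proof
  fix a b c :: "'a padic"
  let ?p = "CARD('a)"
  note [simp] = padic_rel_def pnull_0[OF prime_card] pcauchy_const[OF prime_card]
    pcauchy_add[OF prime_card] pcauchy_mult[OF prime_card] pcauchy_minus[OF prime_card]
  show "a + b + c = a + (b + c)" by transfer (simp add: algebra_simps)
  show "a + b = b + a" by transfer (simp add: algebra_simps)
  show "0 + a = a" by transfer simp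
  show "- a + a = 0" by transfer simp
  show "a - b = a + - b" by (simp add: minus_padic_def)
  show "a * b * c = a * (b * c)" by transfer (simp add: algebra_simps)
  show "a * b = b * a" by transfer (simp add: algebra_simps)
  show "1 * a = a" by transfer simp
  show "(a + b) * c = a * c + b * c" by transfer (simp add: algebra_simps)
  show "(0::'a padic) \<noteq> 1" by transfer (simp add: pnull_def prime_card LIMSEQ_const_iff)
  show "a div b = a * inverse b" by (simp add: divide_padic_def)
  show "inverse (0::'a padic) = 0" by transfer simp
  assume "a \<noteq> 0"
  then show "inverse a * a = 1"
  proof transfer
    fix X assume X: "padic_rel ?p X X" and nz: "\<not> padic_rel ?p X (\<lambda>n. 0)"
    then have c: "pcauchy ?p X" and n: "\<not> pnull ?p X" by auto
    obtain b k where k: "b > 0" "\<And>n. n \<ge> k \<Longrightarrow> pabs ?p (X n) > b"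
      by (rule pcauchy_not_null[OF prime_card c n]) blast
    have "X n \<noteq> 0" if "n \<ge> k" for n using k(1) k(2)[OF that] by auto
    then have "\<forall>\<^sub>F n in sequentially. 0 = pabs ?p (inverse (X n) * X n - 1)"
      by (auto simp: eventually_sequentially intro!: exI[of _ k])
    then have "pnull ?p (\<lambda>n. inverse (X n) * X n - 1)"
      unfolding pnull_def by (rule Lim_transform_eventually[OF tendsto_const])
    then show "padic_rel ?p
        (\<lambda>n. (if pnull ?p X then \<lambda>n. 0 else (\<lambda>n. inverse (X n))) n * X n) (\<lambda>n. 1)"
      using n c pcauchy_inverse[OF prime_card c n] by simp
  qed
qed

end

text \<open>The $p$-adic absolute value, extended from the rationals by continuity.  The library
  constant \<^const>\<open>norm\<close> is reserved to real normed vector spaces.\<close>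

lift_definition padic_norm :: "'p::prime_card padic \<Rightarrow> real"
  is "\<lambda>X. lim (\<lambda>n. pabs CARD('p) (X n))"
  by (rule padic_rel_limit[OF prime_card])

instantiation padic :: (prime_card) metric_space
begin

definition dist_padic :: "'a padic \<Rightarrow> 'a padic \<Rightarrow> real" where
  "dist_padic x y = padic_norm (x - y)"

definition uniformity_padic :: "('a padic \<times> 'a padic) filter" where
  "uniformity_padic = (INF e\<in>{0<..}. principal {(x, y). dist x y < e})"

definition open_padic :: "'a padic set \<Rightarrow> bool" where
  "open_padic U \<longleftrightarrow> (\<forall>x\<in>U. \<forall>\<^sub>F (x', y) in uniformity. x' = x \<longrightarrow> y \<in> U)"

instance
proof
  fix x y z :: "'a padic" and U :: "'a padic set"
  let ?p = "CARD('a)"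
  show "uniformity = (INF e\<in>{0<..}. principal {(x, y::'a padic). dist x y < e})"
    by (fact uniformity_padic_def)
  show "open U \<longleftrightarrow> (\<forall>x\<in>U. \<forall>\<^sub>F (x', y) in uniformity. x' = x \<longrightarrow> y \<in> U)"
    by (fact open_padic_def)
  have lim: "(\<lambda>n. pabs ?p (X n)) \<longlonglongrightarrow> lim (\<lambda>n. pabs ?p (X n))" if "pcauchy ?p X" for X
    using pcauchy_convergent[OF prime_card that] by (simp add: convergent_LIMSEQ_iff)
  have norm_0: "padic_norm a = 0 \<longleftrightarrow> a = 0" for a :: "'a padic"
  proof transfer
    fix X assume "padic_rel ?p X X"
    then have X: "pcauchy ?p X" by (simp add: padic_rel_def)
    show "lim (\<lambda>n. pabs ?p (X n)) = 0 \<longleftrightarrow> padic_rel ?p X (\<lambda>n. 0)"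
    proof
      assume "lim (\<lambda>n. pabs ?p (X n)) = 0"
      with lim[OF X] have "pnull ?p X" by (simp add: pnull_def)
      then show "padic_rel ?p X (\<lambda>n. 0)"
        by (simp add: padic_rel_def X pcauchy_const[OF prime_card])
    next
      assume "padic_rel ?p X (\<lambda>n. 0)"
      then have "(\<lambda>n. pabs ?p (X n)) \<longlonglongrightarrow> 0" by (simp add: padic_rel_def pnull_def)
      then show "lim (\<lambda>n. pabs ?p (X n)) = 0" by (rule limI)
    qed
  qed
  have norm_add: "padic_norm (a + b) \<le> padic_norm a + padic_norm b" for a b :: "'a padic"
  proof transfer
    fix X Y assume "padic_rel ?p X X" "padic_rel ?p Y Y"
    then have X: "pcauchy ?p X" and Y: "pcauchy ?p Y" by (auto simp: padic_rel_def)
    show "lim (\<lambda>n. pabs ?p (X n + Y n)) \<le> lim (\<lambda>n. pabs ?p (X n)) + lim (\<lambda>n. pabs ?p (Y n))"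
      by (rule LIMSEQ_le[OF lim[OF pcauchy_add[OF prime_card X Y]] tendsto_add[OF lim[OF X] lim[OF Y]]])
        (auto simp: pabs_triangle[OF prime_card])
  qed
  have norm_minus: "padic_norm (- a) = padic_norm a" for a :: "'a padic"
    by transfer (simp add: prime_card padic_rel_def)
  show "dist x y = 0 \<longleftrightarrow> x = y" by (simp add: dist_padic_def norm_0)
  show "dist x y \<le> dist x z + dist y z"
    using norm_add[of "x - z" "z - y"] norm_minus[of "y - z"] by (simp add: dist_padic_def)
qed

end


section \<open>The van der Put functions\<close>

definition padic_ints :: "'p::prime_card padic set" where
  "padic_ints = {x. padic_norm x \<le> 1}"

definition padic_ints_vec :: "('p::prime_card padic ^ 'n::finite) set" where
  "padic_ints_vec = {x. \<forall>i. x $ i \<in> padic_ints}"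

definition padic_digits :: "'p::prime_card padic \<Rightarrow> (nat \<Rightarrow> nat) \<Rightarrow> bool" where
  "padic_digits x d \<longleftrightarrow>
     (\<forall>i. d i < CARD('p)) \<and> (\<lambda>i. of_nat (d i) * of_nat CARD('p) ^ i) sums x"

definition initial_part :: "nat \<Rightarrow> 'p::prime_card padic \<Rightarrow> bool" where
  "initial_part m x \<longleftrightarrow> (\<exists>d N. padic_digits x d \<and> m = (\<Sum>i\<le>N. d i * CARD('p) ^ i))"

definition vdp :: "nat \<Rightarrow> 'p::prime_card padic \<Rightarrow> 'p padic" where
  "vdp m x = (if initial_part m x then 1 else 0)"

definition vdp_prod :: "('n::finite \<Rightarrow> nat) \<Rightarrow> 'p::prime_card padic ^ 'n \<Rightarrow> 'p padic" where
  "vdp_prod m x = (\<Prod>i\<in>UNIV. vdp (m i) (x $ i))"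


section \<open>The Banach space of continuous functions and orthonormal bases\<close>

text \<open>Functions on $\mathbb{Z}_p^n$ are total functions of which only the values on
  \<^const>\<open>padic_ints_vec\<close> matter.\<close>

definition cont_fun :: "('p::prime_card padic ^ 'n::finite \<Rightarrow> 'p padic) set" where
  "cont_fun = {F. continuous_on padic_ints_vec F}"

definition sup_norm :: "('p::prime_card padic ^ 'n::finite \<Rightarrow> 'p padic) \<Rightarrow> real" where
  "sup_norm F = (SUP x\<in>padic_ints_vec. padic_norm (F x))"

text \<open>Convergence of a series over a countable index set is unconditional: the net of all
  finite partial sums converges.\<close>

definition expansion ::
  "('i \<Rightarrow> 'p::prime_card padic ^ 'n::finite \<Rightarrow> 'p padic) \<Rightarrow> ('i \<Rightarrow> 'p padic) \<Rightarrow>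
   ('p padic ^ 'n \<Rightarrow> 'p padic) \<Rightarrow> bool" where
  "expansion E A F \<longleftrightarrow>
     ((\<lambda>M. sup_norm (\<lambda>x. F x - (\<Sum>m\<in>M. A m * E m x))) \<longlongrightarrow> 0) (finite_subsets_at_top UNIV)"

definition orthonormal_basis ::
  "('i \<Rightarrow> 'p::prime_card padic ^ 'n::finite \<Rightarrow> 'p padic) \<Rightarrow> bool" where
  "orthonormal_basis E \<longleftrightarrow>
     (\<forall>m. E m \<in> cont_fun) \<and>
     (\<forall>F\<in>cont_fun.
        (\<exists>!A. expansion E A F) \<and>
        (\<forall>A. expansion E A F \<longrightarrow>
           bdd_above (range (\<lambda>m. padic_norm (A m))) \<and> sup_norm F = (SUP m. padic_norm (A m))))"


section \<open>Iterated differences\<close>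

text \<open>Removal of the leading base-\<open>p\<close> digit.\<close>

definition star :: "nat \<Rightarrow> nat \<Rightarrow> nat" where
  "star p m = (\<Sum>i<nat \<lfloor>log (real p) (real m)\<rfloor>. (m div p ^ i mod p) * p ^ i)"

text \<open>\<open>iter_diff F m idx l\<close> is $\phi_l$, where \<open>idx 1, \<dots>, idx k\<close> are the indices
  $i_1, \dots, i_k$.  It is a function of a full tuple \<open>y\<close>; the entries of \<open>y\<close> at the hatted
  places \<open>idx 1, \<dots>, idx l\<close> are overwritten and do not matter.\<close>

fun iter_diff :: "('p::prime_card padic ^ 'n::finite \<Rightarrow> 'p padic) \<Rightarrow> ('n \<Rightarrow> nat) \<Rightarrow>
    (nat \<Rightarrow> 'n) \<Rightarrow> nat \<Rightarrow> ('n \<Rightarrow> nat) \<Rightarrow> 'p padic" where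
  "iter_diff F m idx 0 y = F (\<chi> i. of_nat (y i))"
| "iter_diff F m idx (Suc l) y =
     iter_diff F m idx l (y(idx (Suc l) := m (idx (Suc l)))) -
     iter_diff F m idx l (y(idx (Suc l) := star CARD('p) (m (idx (Suc l)))))"

end

theory Submission
  imports Defs
begin

text \<open>
  At a point with natural number coordinates \<open>y\<close> only finitely many \<open>E\<^sub>m\<close> are nonzero, namely those
  with every \<open>m\<^sub>i\<close> an initial part of \<open>y\<^sub>i\<close>, so an expansion gives
  \<open>F(y) = \<Sum> A\<^sub>m\<close> over this box.  For \<open>m \<ge> p\<close> the initial parts of \<open>m\<close> are those of
  \<open>m\<^sup>*\<close> together with \<open>m\<close> itself.  Hence every difference step of \<open>\<phi>\<^sub>l\<close> shrinks one side of the
  box to a single point, and \<open>\<phi>\<^sub>k\<close> is the sum over the single point \<open>m\<close>.  Conversely, the equations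
  \<open>F(y) = \<Sum> A\<^sub>m\<close> determine some \<open>A\<close> recursively; the partial sum over all \<open>m\<close> with entries below
  \<open>p\<^sup>N\<close> is then \<open>F\<close> evaluated at the truncation of the argument modulo \<open>p\<^sup>N\<close>.  Uniform continuity on
  the compact set $\mathbb{Z}_p^n$ makes it converge, and the remaining \<open>A\<^sub>m\<close> are small because the
  iterated difference may be started at an index \<open>i\<close> with \<open>m\<^sub>i \<ge> p\<^sup>N\<close>.
\<close>

section \<open>The absolute value on the $p$-adic numbers\<close>

lemma padic_norm_nonneg [simp]: "padic_norm x \<ge> 0"
  using zero_le_dist[of x 0] by (simp add: dist_padic_def)

lemma padic_norm_zero [simp]: "padic_norm 0 = 0"
  by (metis dist_self dist_padic_def diff_self)

lemma padic_norm_minus_commute: "padic_norm (x - y) = padic_norm (y - x)"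
  using dist_commute[of x y] by (simp add: dist_padic_def)

lemma tendsto_pabs_lim:
  assumes "prime p" "pcauchy p X"
  shows "(\<lambda>n. pabs p (X n)) \<longlonglongrightarrow> lim (\<lambda>n. pabs p (X n))"
  using pcauchy_convergent[OF assms] by (simp add: convergent_LIMSEQ_iff)

text \<open>The ultrametric inequality holds termwise along representing Cauchy sequences and passes
  to the limit. The metric structure alone gives only the ordinary triangle inequality.\<close>

lemma padic_norm_add: "padic_norm (x + y) \<le> max (padic_norm x) (padic_norm (y :: 'p::prime_card padic))"
proof transfer
  fix X Y
  assume "padic_rel CARD('p) X X" "padic_rel CARD('p) Y Y"
  then have X: "pcauchy CARD('p) X" and Y: "pcauchy CARD('p) Y" by (auto simp: padic_rel_def)
  note lim = tendsto_pabs_lim[OF prime_card]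
  show "lim (\<lambda>n. pabs CARD('p) (X n + Y n)) \<le>
      max (lim (\<lambda>n. pabs CARD('p) (X n))) (lim (\<lambda>n. pabs CARD('p) (Y n)))"
    by (rule LIMSEQ_le[OF lim[OF pcauchy_add[OF prime_card X Y]] tendsto_max[OF lim[OF X] lim[OF Y]]])
      (use pabs_add[OF prime_card] in blast)
qed

lemma padic_norm_add_le:
  "padic_norm x \<le> e \<Longrightarrow> padic_norm y \<le> e \<Longrightarrow> padic_norm (x + y) \<le> e"
  using padic_norm_add[of x y] by linarith

lemma padic_norm_diff_le:
  "padic_norm x \<le> e \<Longrightarrow> padic_norm y \<le> e \<Longrightarrow> padic_norm (x - y) \<le> e"
  using padic_norm_add_le[of x e "- y"] padic_norm_minus_commute[of 0 y] by simp

text \<open>By the ultrametric inequality, lying within a fixed distance is transitive, so chains of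
  approximations never enlarge the constant.\<close>

lemma padic_norm_diff_trans:
  "padic_norm (x - y) \<le> e \<Longrightarrow> padic_norm (y - z) \<le> e \<Longrightarrow> padic_norm (x - z) \<le> e"
  using padic_norm_add_le[of "x - y" e "y - z"] by simp

lemma padic_norm_sum_le:
  assumes "e \<ge> 0" "\<And>m. m \<in> M \<Longrightarrow> padic_norm (f m) \<le> e"
  shows "padic_norm (\<Sum>m\<in>M. f m) \<le> e"
  using assms by (induction M rule: infinite_finite_induct) (auto intro: padic_norm_add_le)

section \<open>The dense image of the rationals\<close>

lift_definition padic_of_rat :: "rat \<Rightarrow> 'p::prime_card padic" is "\<lambda>q n. q"
  by (simp add: padic_rel_refl prime_card pcauchy_const)

lemma padic_of_rat_diff: "padic_of_rat (q - r) = padic_of_rat q - padic_of_rat r"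
  unfolding minus_padic_def by transfer (simp add: padic_rel_refl prime_card pcauchy_const)

lemma padic_of_rat_of_nat [simp]: "padic_of_rat (of_nat n) = (of_nat n :: 'p::prime_card padic)"
proof (induction n)
  case 0
  show ?case by simp (transfer, simp add: padic_rel_refl prime_card pcauchy_const)
next
  case (Suc n)
  have "padic_of_rat (1 + of_nat n) = 1 + (padic_of_rat (of_nat n) :: 'p padic)"
    by transfer (simp add: padic_rel_refl prime_card pcauchy_const)
  then show ?case using Suc by simp
qed

lemma padic_norm_of_rat: "padic_norm (padic_of_rat q :: 'p::prime_card padic) = pabs CARD('p) q"
  by transfer simp

text \<open>A late term of a Cauchy sequence representing \<open>x\<close>, taken as a constant
  sequence, is close to \<open>x\<close>.\<close>

lemma padic_of_rat_dense:
  fixes x :: "'p::prime_card padic"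
  assumes "e > 0"
  obtains q where "padic_norm (x - padic_of_rat q) < e"
proof -
  have "\<exists>q. padic_norm (x + - padic_of_rat q) < e"
    using assms
  proof transfer
    fix e :: real and X
    assume e: "0 < e" and "padic_rel CARD('p) X X"
    then have X: "pcauchy CARD('p) X" by (simp add: padic_rel_def)
    \<comment> \<open>A limit preserves only weak inequalities; \<open>e / 2\<close> leaves room for
      the strict one.\<close>
    obtain k where k: "\<And>m n. m \<ge> k \<Longrightarrow> n \<ge> k \<Longrightarrow> pabs CARD('p) (X m - X n) < e / 2"
      using X e unfolding pcauchy_def by (meson half_gt_zero)
    have c: "pcauchy CARD('p) (\<lambda>n. X n + - X k)"
      by (intro pcauchy_add pcauchy_const X prime_card)
    have "lim (\<lambda>n. pabs CARD('p) (X n + - X k)) \<le> e / 2"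
      by (rule LIMSEQ_le_const2[OF tendsto_pabs_lim[OF prime_card c]])
        (use k[of _ k] in \<open>auto intro!: exI[of _ k] less_imp_le\<close>)
    with e show "\<exists>q. lim (\<lambda>n. pabs CARD('p) (X n + - q)) < e"
      by (intro exI[of _ "X k"]) simp
  qed
  then obtain q where "padic_norm (x + - padic_of_rat q) < e" by blast
  then show thesis by (intro that[of q]) simp
qed

text \<open>For nonzero \<open>a\<close> both sides say that the p-adic valuation of
  \<open>a\<close> is at least \<open>k\<close>.\<close>

lemma pabs_of_int_le_iff:
  assumes p: "prime p"
  shows "pabs p (of_int a) \<le> (1 / real p) ^ k \<longleftrightarrow> int p ^ k dvd a"
proof (cases "a = 0")
  case False
  have p1: "real p > 1" using prime_gt_1_nat[OF p] by simp
  have "pabs p (of_int a) = real p powi (- int (multiplicity (int p) a))"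
    using pabs_frac[OF p False, of 1] by simp
  moreover have "(1 / real p) ^ k = real p powi (- int k)"
    by (simp add: power_int_minus power_one_over inverse_eq_divide)
  moreover have "real p powi (- int n) \<le> real p powi (- int k) \<longleftrightarrow> k \<le> n" for n
  proof -
    have "real p powi (- int j) = inverse (real p ^ j)" for j
      by (simp add: power_int_minus)
    then show ?thesis using p1 by simp
  qed
  ultimately have "pabs p (of_int a) \<le> (1 / real p) ^ k \<longleftrightarrow> k \<le> multiplicity (int p) a"
    by simp
  also have "\<dots> \<longleftrightarrow> int p ^ k dvd a"
    using False p by (subst power_dvd_iff_le_multiplicity) (auto simp: prime_gt_1_nat)
  finally show ?thesis .
qed simp

section \<open>Truncations and digits of $p$-adic integers\<close>

text \<open>This dictionary between distances and congruences modulo powers of p carries the later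
  arguments about digits.\<close>

lemma padic_norm_of_nat_diff_le_iff:
  "padic_norm (of_nat a - of_nat b :: 'p::prime_card padic) \<le> (1 / real CARD('p)) ^ k \<longleftrightarrow>
    [a = b] (mod CARD('p) ^ k)"
proof -
  have "(of_nat a - of_nat b :: 'p padic) = padic_of_rat (of_int (int a - int b))"
    by (simp add: padic_of_rat_diff)
  then have "padic_norm (of_nat a - of_nat b :: 'p padic) \<le> (1 / real CARD('p)) ^ k \<longleftrightarrow>
      int CARD('p) ^ k dvd int a - int b"
    by (simp only: padic_norm_of_rat pabs_of_int_le_iff[OF prime_card])
  then show ?thesis
    by (simp add: cong_iff_dvd_diff flip: cong_int_iff)
qed

lemma padic_norm_of_nat_le_1 [simp]: "padic_norm (of_nat a :: 'p::prime_card padic) \<le> 1"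
  using padic_norm_of_nat_diff_le_iff[of a 0 0, where 'p = 'p] by simp

lemma of_nat_in_padic_ints [simp]: "of_nat a \<in> padic_ints"
  by (simp add: padic_ints_def)

text \<open>For a / b in lowest terms, absolute value at most 1 forces b to be prime to p. Then b
  has an inverse c modulo p^k, and the residue of a c is the approximation.\<close>

lemma nat_approx_rat:
  assumes p: "prime p" and q: "pabs p q \<le> 1"
  obtains r where "r < p ^ k" "pabs p (q - of_nat r) \<le> (1 / real p) ^ k"
proof -
  obtain a b where ab: "quotient_of q = (a, b)" by (cases "quotient_of q") auto
  have b: "b > 0" using quotient_of_denom_pos[OF ab] .
  have qab: "q = of_int a / of_int b" using quotient_of_div[OF ab] .
  have cop: "coprime a b" using quotient_of_coprime[OF ab] .
  have pnd: "\<not> int p dvd b"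
  proof
    \<comment> \<open>If \<open>p\<close> divided \<open>b\<close>, then \<open>a\<close> would be
      prime to \<open>p\<close>, and the absolute value of \<open>q\<close> would be a positive
      power of \<open>p\<close>.\<close>
    assume pb: "int p dvd b"
    then have "\<not> int p dvd a"
      using cop p by (metis coprime_common_divisor_int not_prime_unit prime_int_nat_transfer zdvd1_eq
          prime_nat_int_transfer abs_of_nat not_prime_1 of_nat_eq_1_iff)
    then have a0: "a \<noteq> 0" "multiplicity (int p) a = 0"
      by (auto simp: not_dvd_imp_multiplicity_0)
    have m: "multiplicity (int p) b > 0"
      using pb b p by (simp add: prime_multiplicity_gt_zero_iff)
    have "1 = real p powi 0" by simp
    also have "\<dots> < real p powi int (multiplicity (int p) b)"
      using m prime_gt_1_nat[OF p] by (intro power_int_strict_increasing) auto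
    also have "\<dots> = pabs p q"
      unfolding qab using a0 b by (simp add: pabs_frac[OF p])
    finally show False using q by simp
  qed
  have "coprime b (int p ^ k)"
    using prime_imp_coprime[of "int p" b] pnd p by (simp add: coprime_commute)
  then obtain c where c: "[b * c = 1] (mod int p ^ k)"
    using cong_solve_coprime_int by blast
  define r where "r = nat ((a * c) mod int p ^ k)"
  have pk: "int p ^ k > 0" using prime_gt_0_nat[OF p] by simp
  have r: "int r = (a * c) mod int p ^ k"
    using pk by (simp add: r_def)
  have "int r < int p ^ k" using pk unfolding r by simp
  then have "r < p ^ k" by (simp flip: of_nat_power)
  have "[b * int r = b * (a * c)] (mod int p ^ k)"
    by (simp add: r cong_def mod_mult_right_eq)
  also have "b * (a * c) = a * (b * c)" by simp
  also have "[a * (b * c) = a * 1] (mod int p ^ k)"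
    using c by (rule cong_scalar_left)
  finally have dv: "int p ^ k dvd a - b * int r"
    by (simp add: cong_iff_dvd_diff dvd_diff_commute)
  \<comment> \<open>The error is the integer a - b r divided by b, and dividing by b is harmless
    because b has absolute value 1.\<close>
  have "q - of_nat r = of_int (a - b * int r) * inverse (of_int b)"
    using b by (simp add: qab field_simps)
  moreover have "pabs p (of_int b) = 1"
    using pabs_frac[OF p, of b 1] b pnd by (simp add: not_dvd_imp_multiplicity_0)
  ultimately have "pabs p (q - of_nat r) = pabs p (of_int (a - b * int r))"
    by (simp only: pabs_mult[OF p] pabs_inverse[OF p]) simp
  also have "\<dots> \<le> (1 / real p) ^ k"
    using dv by (simp only: pabs_of_int_le_iff[OF p])
  finally show thesis using that \<open>r < p ^ k\<close> by blast
qed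

lemma inverse_card_power_pos: "(1 / real CARD('p::prime_card)) ^ k > 0"
  using prime_gt_0_nat[OF prime_card[where 'a = 'p]] by simp

lemma inverse_card_power_mono:
  "j \<le> k \<Longrightarrow> (1 / real CARD('p::prime_card)) ^ k \<le> (1 / real CARD('p)) ^ j"
  using prime_ge_1_nat[OF prime_card[where 'a = 'p]] by (intro power_decreasing) auto

lemma tendsto_inverse_card_power: "(\<lambda>k. (1 / real CARD('p::prime_card)) ^ k) \<longlonglongrightarrow> 0"
  using prime_gt_1_nat[OF prime_card[where 'a = 'p]] by (intro LIMSEQ_power_zero) auto

text \<open>A rational close to \<open>x\<close> is itself p-integral by the ultrametric inequality,
  hence can be replaced by a natural number within the same bound.\<close>

lemma nat_approx_padic:
  fixes x :: "'p::prime_card padic"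
  assumes "x \<in> padic_ints"
  shows "\<exists>r<CARD('p) ^ k. padic_norm (x - of_nat r) \<le> (1 / real CARD('p)) ^ k"
proof -
  obtain q where q: "padic_norm (x - padic_of_rat q) < (1 / real CARD('p)) ^ k"
    using padic_of_rat_dense[OF inverse_card_power_pos[where 'p = 'p]] by blast
  have "padic_norm (x - padic_of_rat q) \<le> 1"
    using q inverse_card_power_mono[of 0 k, where 'p = 'p] by simp
  then have "padic_norm (x - (x - padic_of_rat q)) \<le> 1"
    using assms by (intro padic_norm_diff_le[of x 1 "x - padic_of_rat q"]) (auto simp: padic_ints_def)
  then have "pabs CARD('p) q \<le> 1" by (simp add: padic_norm_of_rat)
  from nat_approx_rat[OF prime_card this]
  obtain r where r: "r < CARD('p) ^ k" "pabs CARD('p) (q - of_nat r) \<le> (1 / real CARD('p)) ^ k"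
    by blast
  have "padic_norm (padic_of_rat q - of_nat r :: 'p padic) \<le> (1 / real CARD('p)) ^ k"
    using r(2) by (simp flip: padic_norm_of_rat[where 'p = 'p] add: padic_of_rat_diff)
  then show ?thesis
    using padic_norm_diff_trans[OF less_imp_le[OF q]] r(1) by blast
qed

text \<open>The residue of \<open>x\<close> modulo p^k, that is, the sum of its first k digit terms.
  Defining it by approximation makes it available before digit expansions are known to exist; on
  \<open>padic_ints\<close> the choice is unique.\<close>

definition padic_trunc :: "nat \<Rightarrow> 'p::prime_card padic \<Rightarrow> nat" where
  "padic_trunc k x =
    (SOME r. r < CARD('p) ^ k \<and> padic_norm (x - of_nat r) \<le> (1 / real CARD('p)) ^ k)"

lemma padic_trunc:
  fixes x :: "'p::prime_card padic"
  assumes "x \<in> padic_ints"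
  shows "padic_trunc k x < CARD('p) ^ k"
    and "padic_norm (x - of_nat (padic_trunc k x)) \<le> (1 / real CARD('p)) ^ k"
  using someI_ex[OF nat_approx_padic[OF assms]] unfolding padic_trunc_def by blast+

lemma padic_trunc_eqI:
  fixes x :: "'p::prime_card padic"
  assumes "x \<in> padic_ints" "r < CARD('p) ^ k"
    "padic_norm (x - of_nat r) \<le> (1 / real CARD('p)) ^ k"
  shows "padic_trunc k x = r"
proof -
  have "padic_norm (of_nat (padic_trunc k x) - x) \<le> (1 / real CARD('p)) ^ k"
    using padic_trunc(2)[OF assms(1)] by (subst padic_norm_minus_commute)
  then have "padic_norm (of_nat (padic_trunc k x) - of_nat r :: 'p padic) \<le> (1 / real CARD('p)) ^ k"
    using assms(3) by (rule padic_norm_diff_trans)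
  then show ?thesis
    using padic_trunc(1)[OF assms(1), of k] assms(2)
    by (simp add: padic_norm_of_nat_diff_le_iff cong_def)
qed

lemma padic_trunc_of_nat [simp]:
  "padic_trunc k (of_nat n :: 'p::prime_card padic) = n mod CARD('p) ^ k"
  by (rule padic_trunc_eqI) (simp_all add: padic_norm_of_nat_diff_le_iff cong_def)

lemma padic_trunc_eq_if_close:
  fixes x y :: "'p::prime_card padic"
  assumes "x \<in> padic_ints" "y \<in> padic_ints" "padic_norm (x - y) \<le> (1 / real CARD('p)) ^ k"
  shows "padic_trunc k x = padic_trunc k y"
  using assms(1) padic_trunc(1)[OF assms(2)]
    padic_norm_diff_trans[OF assms(3) padic_trunc(2)[OF assms(2)]]
  by (rule padic_trunc_eqI)

text \<open>\<open>x\<close> and its truncation at \<open>k\<close> are within p^(-j) of each other,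
  so they have the same truncation at \<open>j\<close>.\<close>

lemma padic_trunc_mod:
  fixes x :: "'p::prime_card padic"
  assumes "x \<in> padic_ints" "j \<le> k"
  shows "padic_trunc k x mod CARD('p) ^ j = padic_trunc j x"
proof -
  have "padic_trunc j x = padic_trunc j (of_nat (padic_trunc k x) :: 'p padic)"
    using assms padic_trunc(2)[OF assms(1), of k] inverse_card_power_mono[OF assms(2), where 'p = 'p]
    by (intro padic_trunc_eq_if_close) auto
  then show ?thesis by simp
qed

section \<open>Digit expansions and initial parts of p-adic integers\<close>

lemma sum_digits_less:
  fixes d :: "nat \<Rightarrow> nat"
  assumes "\<And>i. d i < b"
  shows "(\<Sum>i<k. d i * b ^ i) < b ^ k"
proof (induction k)
  case (Suc k)
  have "d k * b ^ k + b ^ k \<le> b * b ^ k"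
    using mult_right_mono[of "Suc (d k)" b "b ^ k"] assms[of k] by simp
  with Suc show ?case by simp
qed simp

text \<open>Partial sums with at least k terms are all congruent modulo p^k to the one with k terms,
  and they converge to \<open>x\<close>.\<close>

lemma padic_digits_approx:
  fixes x :: "'p::prime_card padic"
  assumes "padic_digits x d"
  shows "padic_norm (x - of_nat (\<Sum>i<k. d i * CARD('p) ^ i)) \<le> (1 / real CARD('p)) ^ k"
proof -
  let ?S = "\<lambda>k. \<Sum>i<k. d i * CARD('p) ^ i"
  have "(\<lambda>n. of_nat (?S n) :: 'p padic) \<longlonglongrightarrow> x"
    using assms by (simp add: padic_digits_def sums_def)
  from metric_LIMSEQ_D[OF this inverse_card_power_pos[of k, where 'p = 'p]]
  obtain n0 where n0: "\<And>n. n \<ge> n0 \<Longrightarrow> padic_norm (of_nat (?S n) - x) < (1 / real CARD('p)) ^ k"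
    by (auto simp: dist_padic_def)
  define n where "n = max n0 k"
  have "?S n = ?S k + (\<Sum>i\<in>{k..<n}. d i * CARD('p) ^ i)"
    by (subst sum.union_disjoint[symmetric]) (auto simp: n_def intro!: sum.cong)
  moreover have "CARD('p) ^ k dvd (\<Sum>i\<in>{k..<n}. d i * CARD('p) ^ i)"
    by (intro dvd_sum dvd_mult le_imp_power_dvd) auto
  ultimately have "[?S n = ?S k] (mod CARD('p) ^ k)"
    by (auto simp: cong_def elim!: dvdE)
  then have "padic_norm (of_nat (?S n) - of_nat (?S k) :: 'p padic) \<le> (1 / real CARD('p)) ^ k"
    by (simp only: padic_norm_of_nat_diff_le_iff)
  moreover have "padic_norm (x - of_nat (?S n)) \<le> (1 / real CARD('p)) ^ k"
    using n0[of n] padic_norm_minus_commute[of x "of_nat (?S n)"] by (simp add: n_def)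
  ultimately show ?thesis by (metis padic_norm_diff_trans)
qed

lemma padic_digits_trunc:
  fixes x :: "'p::prime_card padic"
  assumes "x \<in> padic_ints" "padic_digits x d"
  shows "padic_trunc k x = (\<Sum>i<k. d i * CARD('p) ^ i)"
  using assms padic_digits_approx[OF assms(2)]
  by (intro padic_trunc_eqI sum_digits_less) (auto simp: padic_digits_def)

text \<open>The i-th digit is the top digit of the truncation at \<open>Suc i\<close>. Since
  truncations are compatible under reduction, the partial sums are the truncations
  themselves.\<close>

lemma padic_digits_exist:
  fixes x :: "'p::prime_card padic"
  assumes x: "x \<in> padic_ints"
  obtains d where "padic_digits x d"
proof -
  define d where "d i = padic_trunc (Suc i) x div CARD('p) ^ i" for i
  have S: "(\<Sum>i<k. d i * CARD('p) ^ i) = padic_trunc k x" for k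
  proof (induction k)
    case 0
    then show ?case using padic_trunc(1)[OF x, of 0] by simp
  next
    case (Suc k)
    have "(\<Sum>i<Suc k. d i * CARD('p) ^ i) =
        padic_trunc (Suc k) x mod CARD('p) ^ k + padic_trunc (Suc k) x div CARD('p) ^ k * CARD('p) ^ k"
      using Suc padic_trunc_mod[OF x, of k "Suc k"] by (simp add: d_def)
    then show ?case by (simp only: mod_div_mult_eq)
  qed
  have "(\<lambda>n. of_nat (padic_trunc n x)) \<longlonglongrightarrow> x"
  proof (rule metric_LIMSEQ_I)
    fix e :: real assume "e > 0"
    from order_tendstoD(2)[OF tendsto_inverse_card_power[where 'p = 'p] this]
    obtain n0 where n0: "\<And>n. n \<ge> n0 \<Longrightarrow> (1 / real CARD('p)) ^ n < e"
      by (auto simp: eventually_sequentially)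
    show "\<exists>n0. \<forall>n\<ge>n0. dist (of_nat (padic_trunc n x)) x < e"
    proof (intro exI allI impI)
      fix n assume "n \<ge> n0"
      have "dist (of_nat (padic_trunc n x)) x \<le> (1 / real CARD('p)) ^ n"
        using padic_trunc(2)[OF x, of n] by (subst dist_commute) (simp add: dist_padic_def)
      then show "dist (of_nat (padic_trunc n x)) x < e" using n0[OF \<open>n \<ge> n0\<close>] by simp
    qed
  qed
  moreover have "(\<Sum>i<n. of_nat (d i) * of_nat CARD('p) ^ i) = (of_nat (padic_trunc n x) :: 'p padic)" for n
    by (simp flip: S)
  ultimately have "(\<lambda>i. of_nat (d i) * of_nat CARD('p) ^ i) sums x"
    by (simp add: sums_def)
  moreover have "d i < CARD('p)" for i
    unfolding d_def by (rule less_mult_imp_div_less) (use padic_trunc(1)[OF x, of "Suc i"] in simp)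
  ultimately show thesis using that unfolding padic_digits_def by blast
qed

text \<open>Partial sums of any digit expansion are truncations, so the expansion chosen in
  \<open>initial_part\<close> does not matter. The bound on \<open>k\<close> reflects that an
  initial part includes at least the digit x_0.\<close>

lemma initial_part_iff:
  fixes x :: "'p::prime_card padic"
  assumes x: "x \<in> padic_ints"
  shows "initial_part m x \<longleftrightarrow> (\<exists>k\<ge>1. padic_trunc k x = m)"
proof -
  obtain d where d: "padic_digits x d" using padic_digits_exist[OF x] .
  have "initial_part m x \<longleftrightarrow> (\<exists>N. m = padic_trunc (Suc N) x)"
    using d padic_digits_trunc[OF x] unfolding initial_part_def lessThan_Suc_atMost[symmetric] by metis
  also have "\<dots> \<longleftrightarrow> (\<exists>k\<ge>1. padic_trunc k x = m)"
    by (metis One_nat_def Suc_le_D Suc_le_mono zero_le)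
  finally show ?thesis .
qed

text \<open>The analogue for natural numbers. The empty truncation \<open>k = 0\<close> is excluded,
  since otherwise 0 would always belong.\<close>

definition initial_parts :: "nat \<Rightarrow> nat \<Rightarrow> nat set" where
  "initial_parts p n = {n mod p ^ k | k. k \<ge> 1}"

text \<open>If a truncation at \<open>k > N\<close> is below p^N, it equals the truncation at
  \<open>N\<close>; hence the first N digits of \<open>x\<close> decide.\<close>

lemma initial_part_iff_mem_initial_parts:
  fixes x :: "'p::prime_card padic"
  assumes x: "x \<in> padic_ints" and N: "N \<ge> 1" and m: "m < CARD('p) ^ N"
  shows "initial_part m x \<longleftrightarrow> m \<in> initial_parts CARD('p) (padic_trunc N x)"
proof
  assume "initial_part m x"
  then obtain k where k: "k \<ge> 1" "padic_trunc k x = m"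
    using initial_part_iff[OF x] by blast
  have "m = padic_trunc N x mod CARD('p) ^ min k N"
    using padic_trunc_mod[OF x, of N k] padic_trunc_mod[OF x, of k N] k m by (auto simp: min_def)
  then show "m \<in> initial_parts CARD('p) (padic_trunc N x)"
    using k N by (auto simp: initial_parts_def intro!: exI[of _ "min k N"])
next
  assume "m \<in> initial_parts CARD('p) (padic_trunc N x)"
  then obtain k where k: "k \<ge> 1" "m = padic_trunc N x mod CARD('p) ^ k"
    by (auto simp: initial_parts_def)
  show "initial_part m x"
  proof (cases "k \<le> N")
    case True
    then show ?thesis using k padic_trunc_mod[OF x True] initial_part_iff[OF x] by metis
  next
    case False
    then have "padic_trunc N x < CARD('p) ^ k"
      using padic_trunc(1)[OF x, of N] power_increasing[of N k "CARD('p)"]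
        prime_ge_1_nat[OF prime_card[where 'a = 'p]] by linarith
    then show ?thesis using k N initial_part_iff[OF x] by auto
  qed
qed

lemma initial_part_of_nat:
  "initial_part m (of_nat n :: 'p::prime_card padic) \<longleftrightarrow> m \<in> initial_parts CARD('p) n"
  by (auto simp: initial_part_iff initial_parts_def)

section \<open>Completeness and compactness\<close>

text \<open>Approximate the n-th term by a rational \<open>q n\<close> within 1 / (n + 1). These
  rationals form a Cauchy sequence, whose class is the limit.\<close>

instance padic :: (prime_card) complete_space
proof
  fix X :: "nat \<Rightarrow> 'a padic"
  assume X: "Cauchy X"
  have "\<exists>q. padic_norm (X n - padic_of_rat q) < inverse (real (Suc n))" for n
    using padic_of_rat_dense[of "inverse (real (Suc n))" "X n"] by auto
  then obtain q where q: "\<And>n. padic_norm (X n - padic_of_rat (q n)) < inverse (real (Suc n))"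
    by metis
  have small: "\<exists>n0. \<forall>n\<ge>n0. padic_norm (X n - padic_of_rat (q n)) < e" if e: "e > 0" for e
  proof -
    obtain n0 where n0: "inverse (real (Suc n0)) < e" using reals_Archimedean[OF e] by blast
    have "padic_norm (X n - padic_of_rat (q n)) < e" if "n \<ge> n0" for n
    proof -
      have "inverse (real (Suc n)) \<le> inverse (real (Suc n0))"
        using that by (intro le_imp_inverse_le) auto
      then show ?thesis using q[of n] n0 by linarith
    qed
    then show ?thesis by blast
  qed
  have cauchy: "pcauchy CARD('a) q"
    unfolding pcauchy_def
  proof (intro allI impI)
    fix e :: real assume e: "e > 0"
    obtain n1 where n1: "\<And>m n. m \<ge> n1 \<Longrightarrow> n \<ge> n1 \<Longrightarrow> padic_norm (X m - X n) < e / 2"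
      using X e unfolding Cauchy_def dist_padic_def by (meson half_gt_zero)
    obtain n2 where n2: "\<And>n. n \<ge> n2 \<Longrightarrow> padic_norm (X n - padic_of_rat (q n)) < e / 2"
      using small[of "e / 2"] e by auto
    have "pabs CARD('a) (q m - q n) < e" if mn: "m \<ge> max n1 n2" "n \<ge> max n1 n2" for m n
    proof -
      have 1: "padic_norm (padic_of_rat (q m) - X m) \<le> e / 2"
        using n2[of m] mn by (subst padic_norm_minus_commute) simp
      have 2: "padic_norm (X m - X n) \<le> e / 2" using n1[of m n] mn by simp
      have 3: "padic_norm (X n - padic_of_rat (q n)) \<le> e / 2" using n2[of n] mn by simp
      have "padic_norm (padic_of_rat (q m) - padic_of_rat (q n) :: 'a padic) \<le> e / 2"
        using padic_norm_diff_trans[OF padic_norm_diff_trans[OF 1 2] 3] .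
      then have "pabs CARD('a) (q m - q n) \<le> e / 2"
        by (simp flip: padic_of_rat_diff add: padic_norm_of_rat)
      then show ?thesis using e by simp
    qed
    then show "\<exists>k. \<forall>m\<ge>k. \<forall>n\<ge>k. pabs CARD('a) (q m - q n) < e" by blast
  qed
  define x :: "'a padic" where "x = padic.abs q"
  \<comment> \<open>Subtraction and absolute value act termwise on representatives, so distances
    from \<open>x\<close> to rationals are limits of rational absolute values.\<close>
  have norm_x: "padic_norm (x - padic_of_rat r) = lim (\<lambda>n. pabs CARD('a) (q n - r))" for r
  proof -
    have "padic_rel CARD('a) q q" "padic_rel CARD('a) (\<lambda>n. - r) (\<lambda>n. - r)"
      "padic_rel CARD('a) (\<lambda>n. r) (\<lambda>n. r)" "padic_rel CARD('a) (\<lambda>n. q n + - r) (\<lambda>n. q n + - r)"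
      by (intro padic_rel_refl prime_card cauchy pcauchy_const pcauchy_add)+
    then show ?thesis
      by (simp add: x_def minus_padic_def padic_of_rat_def uminus_padic.abs_eq plus_padic.abs_eq
          padic_norm.abs_eq del: add_uminus_conv_diff) simp
  qed
  have "X \<longlonglongrightarrow> x"
  proof (rule metric_LIMSEQ_I)
    fix e :: real assume e: "e > 0"
    obtain n1 where n1: "\<And>m n. m \<ge> n1 \<Longrightarrow> n \<ge> n1 \<Longrightarrow> pabs CARD('a) (q m - q n) < e / 2"
      using cauchy e unfolding pcauchy_def by (meson half_gt_zero)
    obtain n2 where n2: "\<And>n. n \<ge> n2 \<Longrightarrow> padic_norm (X n - padic_of_rat (q n)) < e / 2"
      using small[of "e / 2"] e by auto
    have "dist (X n) x < e" if n: "n \<ge> max n1 n2" for n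
    proof -
      have c: "pcauchy CARD('a) (\<lambda>j. q j - q n)"
        using pcauchy_add[OF prime_card cauchy pcauchy_const[OF prime_card, of "- q n"]] by simp
      have "padic_norm (x - padic_of_rat (q n)) \<le> e / 2"
        unfolding norm_x
        by (rule LIMSEQ_le_const2[OF tendsto_pabs_lim[OF prime_card c]])
          (use n1[of _ n] n in \<open>auto intro!: exI[of _ n1] less_imp_le\<close>)
      then have 1: "padic_norm (padic_of_rat (q n) - x) \<le> e / 2"
        by (subst padic_norm_minus_commute)
      have "padic_norm (X n - padic_of_rat (q n)) \<le> e / 2" using n2[of n] n by simp
      from padic_norm_diff_trans[OF this 1] show ?thesis using e by (simp add: dist_padic_def)
    qed
    then show "\<exists>n0. \<forall>n\<ge>n0. dist (X n) x < e" by blast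
  qed
  then show "convergent X" by (rule convergentI)
qed

section \<open>Compactness of Z_p^n\<close>

lemma dist_vec_le:
  fixes x y :: "'a::metric_space ^ 'n::finite"
  assumes "\<And>i. dist (x $ i) (y $ i) \<le> e"
  shows "dist x y \<le> real CARD('n) * e"
proof -
  have "dist x y \<le> (\<Sum>i\<in>UNIV. dist (x $ i) (y $ i))"
    unfolding dist_vec_def by (intro L2_set_le_sum) auto
  also have "\<dots> \<le> (\<Sum>i\<in>(UNIV :: 'n set). e)"
    by (intro sum_mono assms)
  finally show ?thesis by simp
qed

lemma padic_ints_vec_nth [simp]: "x \<in> padic_ints_vec \<Longrightarrow> x $ i \<in> padic_ints"
  by (simp add: padic_ints_vec_def)

lemma of_nat_vec_in_padic_ints_vec [simp]: "(\<chi> i. of_nat (y i)) \<in> padic_ints_vec"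
  unfolding padic_ints_vec_def by simp

text \<open>The metric on vectors is Euclidean; this choice of \<open>N\<close> absorbs the factor
  \<open>CARD('n)\<close> lost when passing from coordinates to vectors.\<close>

lemma ex_inverse_card_power_less:
  assumes "e > 0"
  obtains N where "N \<ge> 1" "real CARD('n::finite) * (1 / real CARD('p::prime_card)) ^ N < e"
proof -
  have "(\<lambda>N. real CARD('n) * (1 / real CARD('p)) ^ N) \<longlonglongrightarrow> real CARD('n) * 0"
    by (intro tendsto_intros tendsto_inverse_card_power)
  then have "\<forall>\<^sub>F N in sequentially. real CARD('n) * (1 / real CARD('p)) ^ N < e"
    using assms by (intro order_tendstoD(2)[of _ 0]) auto
  moreover have "\<forall>\<^sub>F N in sequentially. N \<ge> (1::nat)" by (rule eventually_ge_at_top)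
  ultimately have "\<forall>\<^sub>F N in sequentially. N \<ge> 1 \<and> real CARD('n) * (1 / real CARD('p)) ^ N < e"
    by eventually_elim simp
  then show thesis using that by (auto simp: eventually_sequentially)
qed

text \<open>A closed subset of a complete space is complete, and the points with natural coordinates
  below p^N form a finite net.\<close>

lemma compact_padic_ints_vec: "compact (padic_ints_vec :: ('p::prime_card padic ^ 'n::finite) set)"
proof -
  have "padic_ints_vec = {x :: 'p padic ^ 'n. \<forall>i. dist (x $ i) 0 \<le> 1}"
    by (simp add: padic_ints_vec_def padic_ints_def dist_padic_def)
  also have "closed \<dots>"
    by (intro closed_Collect_all closed_Collect_le continuous_intros)
  finally have "complete (padic_ints_vec :: ('p padic ^ 'n) set)"
    by (simp add: complete_eq_closed)
  moreover have "\<exists>K. finite K \<and> (padic_ints_vec :: ('p padic ^ 'n) set) \<subseteq> (\<Union>x\<in>K. ball x e)"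
    if e: "e > 0" for e
  proof -
    obtain N where N: "real CARD('n) * (1 / real CARD('p)) ^ N < e"
      using ex_inverse_card_power_less[OF e] by blast
    let ?Y = "Pi UNIV (\<lambda>_::'n. {..<CARD('p) ^ N})"
    let ?K = "(\<lambda>y. (\<chi> i. of_nat (y i)) :: 'p padic ^ 'n) ` ?Y"
    have "finite ?Y"
      using finite_PiE[of "UNIV :: 'n set" "\<lambda>_. {..<CARD('p) ^ N}"] by (simp add: PiE_def)
    then have "finite ?K" by simp
    moreover have "\<exists>z\<in>?K. x \<in> ball z e" if x: "x \<in> padic_ints_vec" for x
    proof
      let ?z = "(\<chi> i. of_nat (padic_trunc N (x $ i))) :: 'p padic ^ 'n"
      show "?z \<in> ?K"
        using padic_trunc(1)[OF padic_ints_vec_nth[OF x]] by (intro image_eqI[of _ _ "\<lambda>i. padic_trunc N (x $ i)"]) auto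
      have "dist x ?z \<le> real CARD('n) * (1 / real CARD('p)) ^ N"
        using padic_trunc(2)[OF padic_ints_vec_nth[OF x]]
        by (intro dist_vec_le) (simp add: dist_padic_def)
      then show "x \<in> ball ?z e" using N by (simp add: dist_commute)
    qed
    ultimately show ?thesis by (intro exI[of _ ?K]) auto
  qed
  ultimately show ?thesis by (simp add: compact_eq_totally_bounded)
qed

section \<open>Initial parts of natural numbers and iterated differences\<close>

lemma mod_power_in_initial_parts: "k \<ge> 1 \<Longrightarrow> n mod p ^ k \<in> initial_parts p n"
  by (auto simp: initial_parts_def)

lemma initial_parts_le: "m \<in> initial_parts p n \<Longrightarrow> m \<le> n"
  by (auto simp: initial_parts_def)

lemma finite_initial_parts [simp]: "finite (initial_parts p n)"
  by (rule finite_subset[of _ "{..n}"]) (auto dest: initial_parts_le)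

lemma self_in_initial_parts:
  assumes "p \<ge> 2"
  shows "n \<in> initial_parts p n"
proof -
  have "n < 2 ^ n" by (rule less_exp)
  also have "\<dots> \<le> p ^ n" using assms by (intro power_mono) auto
  also have "\<dots> \<le> p ^ Suc n" using assms by (intro power_increasing) auto
  finally show ?thesis using mod_power_in_initial_parts[of "Suc n" n p] by simp
qed

lemma initial_parts_digit: "p \<ge> 2 \<Longrightarrow> m < p \<Longrightarrow> initial_parts p m = {m}"
proof (intro equalityI subsetI)
  fix j assume "p \<ge> 2" "m < p" "j \<in> initial_parts p m"
  then obtain k where k: "k \<ge> 1" "j = m mod p ^ k" by (auto simp: initial_parts_def)
  have "m < p ^ k" using \<open>m < p\<close> \<open>p \<ge> 2\<close> k(1) self_le_power[of p k] by linarith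
  then show "j \<in> {m}" using k by simp
qed (use self_in_initial_parts in auto)

text \<open>Here \<open>s\<close> is the position of the leading digit; the sum of the lower digit
  terms is the remainder modulo p^s.\<close>

lemma star_eq_mod:
  assumes p: "p \<ge> 2" and m: "m \<ge> p"
  obtains s where "s \<ge> 1" "p ^ s \<le> m" "m < p ^ Suc s" "star p m = m mod p ^ s"
proof -
  obtain s where s: "p ^ s \<le> m" "m < p ^ (s + 1)"
    using ex_power_ivl1[of p m] p m by auto
  have "s \<ge> 1" using s(2) m by (cases s) auto
  have "(\<Sum>i<k. (m div p ^ i mod p) * p ^ i) = m mod p ^ k" for k
  proof (induction k)
    case (Suc k)
    have "m mod p ^ Suc k = p ^ k * (m div p ^ k mod p) + m mod p ^ k"
      using mod_mult2_eq[of m "p ^ k" p] by (simp add: mult.commute)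
    with Suc show ?case by (simp add: mult.commute)
  qed simp
  moreover have "\<lfloor>log (real p) (real m)\<rfloor> = int s"
    using floor_log_nat_eq_if[OF s p] by simp
  ultimately have "star p m = m mod p ^ s" by (simp add: star_def)
  then show thesis using that s \<open>s \<ge> 1\<close> by simp
qed

text \<open>Reductions modulo p^k with k at most s do not see the leading digit, and those with k >
  s return \<open>m\<close>. As \<open>star p m\<close> lies below p^s, hence below
  \<open>m\<close>, the new element is not among the old ones.\<close>

lemma initial_parts_star:
  assumes p: "p \<ge> 2" and m: "m \<ge> p"
  shows "initial_parts p m = insert m (initial_parts p (star p m))" "m \<notin> initial_parts p (star p m)"
proof -
  obtain s where s: "s \<ge> 1" "p ^ s \<le> m" "m < p ^ Suc s" and st: "star p m = m mod p ^ s"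
    by (rule star_eq_mod[OF p m])
  have "star p m < p ^ s" using p by (simp add: st)
  then show "m \<notin> initial_parts p (star p m)" using s(2) by (auto dest: initial_parts_le)
  have star: "star p m mod p ^ k = m mod p ^ min k s" for k
  proof (cases "k \<le> s")
    case True
    then show ?thesis by (simp add: st min_def mod_mod_cancel le_imp_power_dvd)
  next
    case False
    then have "star p m < p ^ k"
      using \<open>star p m < p ^ s\<close> p power_increasing[of s k p] by linarith
    then show ?thesis using False by (simp add: st min_def)
  qed
  have big: "m mod p ^ k = m" if "k > s" for k
    using that s(3) p power_increasing[of "Suc s" k p] by (intro mod_less) linarith
  show "initial_parts p m = insert m (initial_parts p (star p m))"
  proof (intro equalityI subsetI)
    fix j assume "j \<in> initial_parts p m"
    then obtain k where k: "k \<ge> 1" "j = m mod p ^ k" by (auto simp: initial_parts_def)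
    show "j \<in> insert m (initial_parts p (star p m))"
    proof (cases "k > s")
      case False
      then have "j = star p m mod p ^ k" using k star[of k] by (simp add: min_def)
      then show ?thesis using mod_power_in_initial_parts[OF k(1)] by simp
    qed (use big k in simp)
  next
    fix j assume "j \<in> insert m (initial_parts p (star p m))"
    \<comment> \<open>The exponent \<open>min k s\<close> is still at least 1 because
      \<open>s\<close> is.\<close>
    then consider "j = m" | k where "k \<ge> 1" "j = m mod p ^ min k s"
      by (auto simp: initial_parts_def star)
    then show "j \<in> initial_parts p m"
      using self_in_initial_parts[OF p] mod_power_in_initial_parts s(1) by cases auto
  qed
qed

text \<open>Deleting the leading digit changes \<open>m\<close> by a multiple of p^s, and the size
  of \<open>m\<close> forces N to be at most s.\<close>

lemma star_cong:
  assumes p: "p \<ge> 2" and N: "N \<ge> 1" and m: "m \<ge> p ^ N"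
  shows "[m = star p m] (mod p ^ N)"
proof -
  have "m \<ge> p" using self_le_power[of p N] p N m by linarith
  then obtain s where s: "m < p ^ Suc s" "star p m = m mod p ^ s"
    by (rule star_eq_mod[OF p])
  have "p ^ N < p ^ Suc s" using m s(1) by linarith
  then have "N \<le> s" using p power_increasing[of "Suc s" N p] by (meson not_less not_less_eq_eq le_trans one_le_numeral)
  then show ?thesis using s(2) by (simp add: cong_def mod_mod_cancel le_imp_power_dvd)
qed

section \<open>Iterated differences as sums of coefficients over boxes\<close>

lemma finite_Pi_UNIV:
  assumes "\<And>i::'n::finite. finite (B i)"
  shows "finite (Pi UNIV B)"
  using finite_PiE[of UNIV B] assms by (simp add: PiE_def)

abbreviation parts_box :: "nat \<Rightarrow> ('n \<Rightarrow> nat) \<Rightarrow> ('n \<Rightarrow> nat) set" where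
  "parts_box p y \<equiv> Pi UNIV (\<lambda>i. initial_parts p (y i))"

text \<open>Each difference collapses one more side of the box to the point \<open>m i\<close>. The
  tuple \<open>y\<close> is generalized in the induction because a step changes one of its
  entries.\<close>

lemma iter_diff_eq_sum:
  fixes F :: "'p::prime_card padic ^ 'n::finite \<Rightarrow> 'p padic"
  assumes F: "\<And>y. (\<Sum>q\<in>parts_box CARD('p) y. A q) = F (\<chi> i. of_nat (y i))"
    and inj: "inj_on idx {1..k}" and ge: "\<And>j. j \<in> {1..k} \<Longrightarrow> m (idx j) \<ge> CARD('p)"
    and "l \<le> k"
  shows "iter_diff F m idx l y =
    (\<Sum>q\<in>Pi UNIV (\<lambda>i. if i \<in> idx ` {1..l} then {m i} else initial_parts CARD('p) (y i)). A q)"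
  using \<open>l \<le> k\<close>
proof (induction l arbitrary: y)
  case 0
  then show ?case by (simp add: F)
next
  case (Suc l)
  let ?p = "CARD('p)" and ?j = "idx (Suc l)"
  let ?S = "\<lambda>l y. Pi UNIV (\<lambda>i. if i \<in> idx ` {1..l} then {m i} else initial_parts ?p (y i))"
  have p: "?p \<ge> 2" using prime_ge_2_nat[OF prime_card[where 'a = 'p]] .
  have new: "?j \<notin> idx ` {1..l}"
  proof
    assume "?j \<in> idx ` {1..l}"
    then obtain j where "j \<in> {1..l}" "idx j = ?j" by auto
    then have "j = Suc l" using Suc.prems by (intro inj_onD[OF inj]) auto
    then show False using \<open>j \<in> {1..l}\<close> by simp
  qed
  have "m ?j \<ge> ?p" using ge[of "Suc l"] Suc.prems by simp
  note star = initial_parts_star[OF p this]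
  have idx: "idx ` {1..Suc l} = insert ?j (idx ` {1..l})"
    by (simp add: atLeastAtMostSuc_conv)
  let ?y1 = "y(?j := m ?j)" and ?y2 = "y(?j := star ?p (m ?j))"
  \<comment> \<open>Separates the coordinate being collapsed from the others, on which the three
    boxes compared below agree.\<close>
  have split_at: "(\<forall>i. P i) \<longleftrightarrow> P ?j \<and> (\<forall>i. i \<noteq> ?j \<longrightarrow> P i)" for P
    by metis
  have S1: "q \<in> ?S l y' \<longleftrightarrow> q ?j \<in> initial_parts ?p (y' ?j) \<and>
      (\<forall>i. i \<noteq> ?j \<longrightarrow> q i \<in> (if i \<in> idx ` {1..l} then {m i} else initial_parts ?p (y' i)))" for q y'
    unfolding Pi_iff ball_UNIV by (subst split_at) (simp only: new if_False)
  have S2: "q \<in> ?S (Suc l) y \<longleftrightarrow> q ?j = m ?j \<and>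
      (\<forall>i. i \<noteq> ?j \<longrightarrow> q i \<in> (if i \<in> idx ` {1..l} then {m i} else initial_parts ?p (y i)))" for q
    unfolding Pi_iff ball_UNIV idx by (subst split_at) (auto simp del: One_nat_def)
  have "?S l ?y1 = ?S l ?y2 \<union> ?S (Suc l) y"
  proof (rule Set.set_eqI)
    fix q
    show "q \<in> ?S l ?y1 \<longleftrightarrow> q \<in> ?S l ?y2 \<union> ?S (Suc l) y"
      unfolding Un_iff S1 S2 using star(1) by (auto simp del: One_nat_def)
  qed
  moreover have "?S l ?y2 \<inter> ?S (Suc l) y = {}"
    using star(2) by (auto simp only: S1 S2 fun_upd_same)
  moreover have "finite (?S l ?y2)" "finite (?S (Suc l) y)"
    by (auto intro!: finite_Pi_UNIV)
  ultimately have "sum A (?S l ?y1) = sum A (?S l ?y2) + sum A (?S (Suc l) y)"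
    by (simp add: sum.union_disjoint)
  then show ?case using Suc by simp
qed

text \<open>Taking \<open>y = m\<close> makes the remaining sides singletons too, since their
  entries are single digits. The case \<open>k = 0\<close> is included.\<close>

lemma coeff_eq_iter_diff:
  fixes F :: "'p::prime_card padic ^ 'n::finite \<Rightarrow> 'p padic"
  assumes F: "\<And>y. (\<Sum>q\<in>parts_box CARD('p) y. A q) = F (\<chi> i. of_nat (y i))"
    and bij: "bij_betw idx {1..k} {i. m i \<ge> CARD('p)}"
  shows "A m = iter_diff F m idx k m"
proof -
  have p: "CARD('p) \<ge> 2" using prime_ge_2_nat[OF prime_card[where 'a = 'p]] .
  have "iter_diff F m idx k m =
      (\<Sum>q\<in>Pi UNIV (\<lambda>i. if i \<in> idx ` {1..k} then {m i} else initial_parts CARD('p) (m i)). A q)"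
    using bij by (intro iter_diff_eq_sum F) (auto simp: bij_betw_def)
  also have "(\<lambda>i. if i \<in> idx ` {1..k} then {m i} else initial_parts CARD('p) (m i)) = (\<lambda>i. {m i})"
    using bij p by (auto simp: bij_betw_def fun_eq_iff initial_parts_digit)
  also have "Pi UNIV (\<lambda>i. {m i}) = {m}" by (auto simp: Pi_iff)
  finally show ?thesis by simp
qed

section \<open>Expansions in van der Put functions\<close>

lemma vdp_prod_eq: "vdp_prod m x = (if \<forall>i. initial_part (m i) (x $ i) then 1 else 0)"
  by (auto simp: vdp_prod_def vdp_def intro: prod_zero)

lemma vdp_prod_eq_box:
  fixes x :: "'p::prime_card padic ^ 'n::finite"
  assumes "x \<in> padic_ints_vec" "N \<ge> 1" "\<forall>i. m i < CARD('p) ^ N"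
  shows "vdp_prod m x = (if m \<in> parts_box CARD('p) (\<lambda>i. padic_trunc N (x $ i)) then 1 else 0)"
  using assms by (simp add: vdp_prod_eq initial_part_iff_mem_initial_parts Pi_iff)

text \<open>At a point with natural coordinates the basis functions, as functions of the index, are
  the indicator of a finite box, so the series is a finite sum there.\<close>

lemma sum_box_eq_if_has_sum:
  fixes F :: "'p::prime_card padic ^ 'n::finite \<Rightarrow> 'p padic"
  assumes "\<forall>x\<in>padic_ints_vec. ((\<lambda>m. A m * vdp_prod m x) has_sum F x) UNIV"
  shows "(\<Sum>q\<in>parts_box CARD('p) y. A q) = F (\<chi> i. of_nat (y i))"
proof -
  let ?x = "(\<chi> i. of_nat (y i)) :: 'p padic ^ 'n"
  have E: "vdp_prod m ?x = (if m \<in> parts_box CARD('p) y then 1 else 0)" for m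
    by (simp add: vdp_prod_eq initial_part_of_nat Pi_iff)
  have "((\<lambda>m. A m * vdp_prod m ?x) has_sum F ?x) UNIV"
    using assms by simp
  then have "(A has_sum F ?x) (parts_box CARD('p) y)"
    by (rule has_sum_cong_neutral[THEN iffD1, rotated -1]) (auto simp: E)
  moreover have "(A has_sum (\<Sum>q\<in>parts_box CARD('p) y. A q)) (parts_box CARD('p) y)"
    by (intro has_sum_finite finite_Pi_UNIV) simp
  ultimately show ?thesis by (metis infsumI)
qed

section \<open>The supremum norm\<close>

lemma bdd_above_padic_norm_image:
  fixes F :: "'p::prime_card padic ^ 'n::finite \<Rightarrow> 'p padic"
  assumes "F \<in> cont_fun"
  shows "bdd_above ((\<lambda>x. padic_norm (F x)) ` padic_ints_vec)"
proof -
  have "compact (F ` padic_ints_vec)"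
    using assms compact_padic_ints_vec by (auto simp: cont_fun_def intro: compact_continuous_image)
  then have "bounded (F ` padic_ints_vec)" by (rule compact_imp_bounded)
  then obtain B where "\<And>x. x \<in> padic_ints_vec \<Longrightarrow> dist (F x) 0 \<le> B"
    by (auto simp: bounded_any_center[of _ 0] dist_commute)
  then show ?thesis
    by (intro bdd_aboveI[of _ B]) (auto simp: dist_padic_def)
qed

lemma zero_in_padic_ints_vec: "0 \<in> padic_ints_vec"
  using of_nat_vec_in_padic_ints_vec[of "\<lambda>_. 0"] by (simp add: zero_vec_def)

lemma sup_norm_le:
  assumes "\<And>x. x \<in> padic_ints_vec \<Longrightarrow> padic_norm (G x) \<le> e"
  shows "sup_norm G \<le> e"
  unfolding sup_norm_def using assms zero_in_padic_ints_vec by (intro cSUP_least) auto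

lemma padic_norm_le_sup_norm:
  assumes "\<And>x. x \<in> padic_ints_vec \<Longrightarrow> padic_norm (G x) \<le> B" "x \<in> padic_ints_vec"
  shows "padic_norm (G x) \<le> sup_norm G"
  unfolding sup_norm_def using assms by (intro cSUP_upper bdd_aboveI[of _ B]) auto

lemma sup_norm_nonneg:
  assumes "\<And>x. x \<in> padic_ints_vec \<Longrightarrow> padic_norm (G x) \<le> B"
  shows "sup_norm G \<ge> 0"
  using padic_norm_le_sup_norm[of G B, OF assms zero_in_padic_ints_vec]
    padic_norm_nonneg[of "G 0"] by linarith

lemma padic_norm_le_sup_norm_cont:
  assumes "F \<in> cont_fun" "x \<in> padic_ints_vec"
  shows "padic_norm (F x) \<le> sup_norm F"
  unfolding sup_norm_def using assms by (intro cSUP_upper bdd_above_padic_norm_image)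

lemma padic_norm_mult_vdp_prod_le: "padic_norm (a * vdp_prod m x) \<le> padic_norm a"
  by (simp add: vdp_prod_eq)

text \<open>A crude bound, uniform in \<open>x\<close>, which ensures that \<open>sup_norm\<close>
  of the residual really dominates its values.\<close>

lemma padic_norm_residual_le:
  fixes F :: "'p::prime_card padic ^ 'n::finite \<Rightarrow> 'p padic"
  assumes F: "F \<in> cont_fun" and x: "x \<in> padic_ints_vec"
  shows "padic_norm (F x - (\<Sum>m\<in>M. A m * vdp_prod m x)) \<le>
    sup_norm F + (\<Sum>m\<in>M. padic_norm (A m))"
proof (cases "finite M")
  case True
  have pos: "sup_norm F \<ge> 0" "(\<Sum>m\<in>M. padic_norm (A m)) \<ge> 0"
    using padic_norm_le_sup_norm_cont[OF F x] padic_norm_nonneg[of "F x"] by (linarith, simp add: sum_nonneg)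
  have "padic_norm (\<Sum>m\<in>M. A m * vdp_prod m x) \<le> (\<Sum>m\<in>M. padic_norm (A m))"
    using True
    by (intro padic_norm_sum_le pos order.trans[OF padic_norm_mult_vdp_prod_le] member_le_sum) auto
  then show ?thesis
    using pos padic_norm_le_sup_norm_cont[OF F x] by (intro padic_norm_diff_le) auto
qed (use padic_norm_le_sup_norm_cont[OF F x] in simp)

lemma expansion_imp_has_sum:
  fixes F :: "'p::prime_card padic ^ 'n::finite \<Rightarrow> 'p padic"
  assumes F: "F \<in> cont_fun" and A: "expansion vdp_prod A F" and x: "x \<in> padic_ints_vec"
  shows "((\<lambda>m. A m * vdp_prod m x) has_sum F x) UNIV"
proof -
  let ?R = "\<lambda>M x. F x - (\<Sum>m\<in>M. A m * vdp_prod m x)"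
  have "dist (\<Sum>m\<in>M. A m * vdp_prod m x) (F x) \<le> sup_norm (?R M)" for M
    using padic_norm_le_sup_norm[of "?R M", OF padic_norm_residual_le[OF F] x]
    by (subst dist_commute) (simp add: dist_padic_def)
  then have "((\<lambda>M. dist (\<Sum>m\<in>M. A m * vdp_prod m x) (F x)) \<longlongrightarrow> 0) (finite_subsets_at_top UNIV)"
    by (intro tendsto_sandwich[OF _ _ tendsto_const A[unfolded expansion_def]]) auto
  then show ?thesis by (simp add: has_sum_def tendsto_dist_iff[symmetric])
qed

text \<open>Uniform continuity on a compact set, restated through coordinatewise congruence modulo
  p^N.\<close>

lemma cont_fun_uniform:
  fixes F :: "'p::prime_card padic ^ 'n::finite \<Rightarrow> 'p padic"
  assumes F: "F \<in> cont_fun" and e: "e > 0"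
  obtains N where "N \<ge> 1"
    "\<And>x y. x \<in> padic_ints_vec \<Longrightarrow> y \<in> padic_ints_vec \<Longrightarrow>
      (\<And>i. padic_norm (x $ i - y $ i) \<le> (1 / real CARD('p)) ^ N) \<Longrightarrow> padic_norm (F x - F y) \<le> e"
proof -
  have "uniformly_continuous_on padic_ints_vec F"
    using F compact_padic_ints_vec by (auto simp: cont_fun_def intro: compact_uniformly_continuous)
  then obtain d where d: "d > 0"
    "\<And>x y. x \<in> padic_ints_vec \<Longrightarrow> y \<in> padic_ints_vec \<Longrightarrow> dist y x < d \<Longrightarrow> dist (F y) (F x) < e"
    using e unfolding uniformly_continuous_on_def by metis
  obtain N where N: "N \<ge> 1" "real CARD('n) * (1 / real CARD('p)) ^ N < d"
    using ex_inverse_card_power_less[OF d(1)] by blast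
  show thesis
  proof (rule that[OF N(1)])
    fix x y :: "'p padic ^ 'n"
    assume xy: "x \<in> padic_ints_vec" "y \<in> padic_ints_vec"
      "\<And>i. padic_norm (x $ i - y $ i) \<le> (1 / real CARD('p)) ^ N"
    have "dist x y \<le> real CARD('n) * (1 / real CARD('p)) ^ N"
      using xy(3) by (intro dist_vec_le) (simp add: dist_padic_def)
    then have "dist (F x) (F y) < e" using N(2) xy by (intro d(2)) auto
    then show "padic_norm (F x - F y) \<le> e" by (simp add: dist_padic_def)
  qed
qed

text \<open>The function is locally constant: once p^N exceeds all entries of \<open>m\<close>, its
  value depends only on the argument modulo p^N.\<close>

lemma vdp_prod_cont: "(vdp_prod m :: 'p::prime_card padic ^ 'n::finite \<Rightarrow> 'p padic) \<in> cont_fun"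
proof -
  have p: "CARD('p) \<ge> 2" using prime_ge_2_nat[OF prime_card[where 'a = 'p]] .
  define N where "N = Suc (\<Sum>i\<in>UNIV. m i)"
  have mN: "\<forall>i. m i < CARD('p) ^ N"
  proof
    fix i
    have "m i \<le> (\<Sum>i\<in>UNIV. m i)" by (rule member_le_sum) auto
    also have "\<dots> < N" by (simp add: N_def)
    also have "N < 2 ^ N" by (rule less_exp)
    also have "\<dots> \<le> CARD('p) ^ N" using p by (intro power_mono) auto
    finally show "m i < CARD('p) ^ N" .
  qed
  have "dist (vdp_prod m y) (vdp_prod m x :: 'p padic) < e"
    if xy: "x \<in> padic_ints_vec" "y \<in> padic_ints_vec" "dist y x < (1 / real CARD('p)) ^ N" and e: "e > 0"
    for x y :: "'p padic ^ 'n" and e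
  proof -
    have "padic_norm (y $ i - x $ i) \<le> (1 / real CARD('p)) ^ N" for i
      using xy(3) dist_vec_nth_le[of y i x] by (simp add: dist_padic_def)
    then have "padic_trunc N (y $ i) = padic_trunc N (x $ i)" for i
      using xy by (intro padic_trunc_eq_if_close) auto
    then have "vdp_prod m y = (vdp_prod m x :: 'p padic)"
      using xy mN by (simp add: vdp_prod_eq_box[of _ N] N_def)
    then show ?thesis using e by simp
  qed
  then show ?thesis
    unfolding cont_fun_def continuous_on_iff
    using inverse_card_power_pos[of N, where 'p = 'p] by blast
qed

text \<open>Solves the triangular system "sum of the coefficients over the box of y = f y". The
  other members of the box are coordinatewise at most \<open>y\<close> and differ from it, so the
  coordinate sum decreases.\<close>

function vdp_coeff :: "nat \<Rightarrow> (('n::finite \<Rightarrow> nat) \<Rightarrow> 'b::ab_group_add) \<Rightarrow> ('n \<Rightarrow> nat) \<Rightarrow> 'b" where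
  "vdp_coeff p f y = f y - (\<Sum>q\<in>parts_box p y - {y}. vdp_coeff p f q)"
  by auto
termination
proof (relation "Wellfounded.measure (\<lambda>(p, f, y). \<Sum>i\<in>UNIV. y i)")
  fix p and f :: "('n::finite \<Rightarrow> nat) \<Rightarrow> 'b" and y q :: "'n \<Rightarrow> nat"
  assume "q \<in> parts_box p y - {y}"
  then have le: "\<And>i. q i \<le> y i" and "q \<noteq> y" by (auto simp: Pi_iff dest: initial_parts_le)
  then obtain i where "q i \<noteq> y i" by auto
  then have "q i < y i" using le[of i] by simp
  then have "(\<Sum>i\<in>UNIV. q i) < (\<Sum>i\<in>UNIV. y i)"
    using le by (intro sum_strict_mono_ex1) auto
  then show "((p, f, q), (p, f, y)) \<in> Wellfounded.measure (\<lambda>(p, f, y). \<Sum>i\<in>UNIV. y i)" by simp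
qed simp

declare vdp_coeff.simps [simp del]

lemma sum_vdp_coeff:
  assumes "p \<ge> 2"
  shows "(\<Sum>q\<in>parts_box p y. vdp_coeff p f q) = f y"
proof -
  have "y \<in> parts_box p y" using self_in_initial_parts[OF assms] by simp
  then have "(\<Sum>q\<in>parts_box p y. vdp_coeff p f q) =
      vdp_coeff p f y + (\<Sum>q\<in>parts_box p y - {y}. vdp_coeff p f q)"
    by (intro sum.remove finite_Pi_UNIV) auto
  then show ?thesis by (simp add: vdp_coeff.simps[of p f y])
qed

section \<open>Size of the coefficients\<close>

lemma padic_norm_iter_diff_le:
  assumes "\<And>x. x \<in> padic_ints_vec \<Longrightarrow> padic_norm (F x) \<le> B"
  shows "padic_norm (iter_diff F m idx l y) \<le> B"
  using assms by (induction l arbitrary: y) (auto intro!: padic_norm_diff_le)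

text \<open>All later differences are formed from first differences, and the ultrametric inequality
  keeps their bound.\<close>

lemma padic_norm_iter_diff_le_first:
  fixes F :: "'p::prime_card padic ^ 'n::finite \<Rightarrow> 'p padic"
  assumes "\<And>y. padic_norm (F (\<chi> j. of_nat ((y(idx 1 := m (idx 1))) j)) -
      F (\<chi> j. of_nat ((y(idx 1 := star CARD('p) (m (idx 1)))) j))) \<le> e"
    and "l \<ge> 1"
  shows "padic_norm (iter_diff F m idx l y) \<le> e"
  using assms(2)
proof (induction l arbitrary: y rule: dec_induct)
  case base
  show ?case using assms(1)[of y] by simp
next
  case (step l)
  then show ?case by (auto intro!: padic_norm_diff_le)
qed

text \<open>Composing an enumeration with a transposition puts a prescribed index first, so that the
  differencing can start where it is known to be small.\<close>

lemma bij_betw_nat_first: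
  assumes "finite I" "i \<in> I"
  obtains idx :: "nat \<Rightarrow> 'a" and k where "k \<ge> 1" "bij_betw idx {1..k} I" "idx 1 = i"
proof -
  obtain h where h: "bij_betw h {1..card I} I"
    using ex_bij_betw_nat_finite_1[OF assms(1)] by blast
  have k: "card I \<ge> 1" using assms by (simp add: Suc_le_eq card_gt_0_iff) blast
  have "i \<in> h ` {1..card I}" using assms(2) bij_betw_imp_surj_on[OF h] by simp
  then obtain j where j: "i = h j" "j \<in> {1..card I}" by (rule imageE)
  have "bij_betw (Transposition.transpose 1 j) {1..card I} {1..card I}"
    using j k by simp
  then have "bij_betw (h \<circ> Transposition.transpose 1 j) {1..card I} I"
    using h by (rule bij_betw_trans)
  then show thesis using that[OF k] j by simp
qed

lemma bij_betw_nat_exists: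
  assumes "finite I"
  obtains idx :: "nat \<Rightarrow> 'a" and k where "bij_betw idx {1..k} I"
  using ex_bij_betw_nat_finite_1[OF assms] by blast

lemma padic_norm_coeff_le:
  fixes F :: "'p::prime_card padic ^ 'n::finite \<Rightarrow> 'p padic"
  assumes A: "\<And>y. (\<Sum>q\<in>parts_box CARD('p) y. A q) = F (\<chi> i. of_nat (y i))" and F: "F \<in> cont_fun"
  shows "padic_norm (A m) \<le> sup_norm F"
proof -
  obtain idx :: "nat \<Rightarrow> 'n" and k where "bij_betw idx {1..k} {i. m i \<ge> CARD('p)}"
    by (rule bij_betw_nat_exists[of "{i. m i \<ge> CARD('p)}"]) auto
  then have "A m = iter_diff F m idx k m" by (rule coeff_eq_iter_diff[OF A])
  then show ?thesis using padic_norm_iter_diff_le[OF padic_norm_le_sup_norm_cont[OF F]] by simp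
qed

text \<open>Start the iterated difference at \<open>i\<close>. Its first step compares
  \<open>F\<close> at points congruent modulo p^N, because removing the leading digit of
  \<open>m i\<close> preserves that residue.\<close>

lemma padic_norm_coeff_small:
  fixes F :: "'p::prime_card padic ^ 'n::finite \<Rightarrow> 'p padic"
  assumes A: "\<And>y. (\<Sum>q\<in>parts_box CARD('p) y. A q) = F (\<chi> i. of_nat (y i))"
    and N: "N \<ge> 1"
    and F: "\<And>x y. x \<in> padic_ints_vec \<Longrightarrow> y \<in> padic_ints_vec \<Longrightarrow>
      (\<And>i. padic_norm (x $ i - y $ i) \<le> (1 / real CARD('p)) ^ N) \<Longrightarrow> padic_norm (F x - F y) \<le> e"
    and m: "m i \<ge> CARD('p) ^ N"
  shows "padic_norm (A m) \<le> e"
proof -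
  have p: "CARD('p) \<ge> 2" using prime_ge_2_nat[OF prime_card[where 'a = 'p]] .
  have "i \<in> {i. m i \<ge> CARD('p)}" using self_le_power[of "CARD('p)" N] p N m by simp
  then obtain idx :: "nat \<Rightarrow> 'n" and k where idx: "k \<ge> 1" "bij_betw idx {1..k} {i. m i \<ge> CARD('p)}" "idx 1 = i"
    by (rule bij_betw_nat_first[OF finite])
  have "A m = iter_diff F m idx k m" by (rule coeff_eq_iter_diff[OF A idx(2)])
  also have "padic_norm \<dots> \<le> e"
  proof (rule padic_norm_iter_diff_le_first[OF _ idx(1)])
    fix y
    have "padic_norm (of_nat ((y(i := m i)) j) - of_nat ((y(i := star CARD('p) (m i))) j) :: 'p padic)
        \<le> (1 / real CARD('p)) ^ N" for j
      using star_cong[OF p N m] by (simp only: padic_norm_of_nat_diff_le_iff) auto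
    then show "padic_norm (F (\<chi> j. of_nat ((y(idx 1 := m (idx 1))) j)) -
        F (\<chi> j. of_nat ((y(idx 1 := star CARD('p) (m (idx 1)))) j))) \<le> e"
      unfolding idx(3) by (intro F of_nat_vec_in_padic_ints_vec) (simp only: vec_lambda_beta)
  qed
  finally show ?thesis .
qed

section \<open>Uniform convergence and orthonormality\<close>

lemma expansion_if_sum_box:
  fixes F :: "'p::prime_card padic ^ 'n::finite \<Rightarrow> 'p padic"
  assumes F: "F \<in> cont_fun" and A: "\<And>y. (\<Sum>q\<in>parts_box CARD('p) y. A q) = F (\<chi> i. of_nat (y i))"
  shows "expansion vdp_prod A F"
  unfolding expansion_def
proof (rule tendstoI)
  fix e :: real assume e: "e > 0"
  let ?R = "\<lambda>M x. F x - (\<Sum>m\<in>M. A m * vdp_prod m x)"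
  obtain N where N: "N \<ge> 1" and unif: "\<And>x y. x \<in> padic_ints_vec \<Longrightarrow> y \<in> padic_ints_vec \<Longrightarrow>
      (\<And>i. padic_norm (x $ i - y $ i) \<le> (1 / real CARD('p)) ^ N) \<Longrightarrow> padic_norm (F x - F y) \<le> e / 2"
    by (rule cont_fun_uniform[OF F, of "e / 2"]) (use e in auto)
  define S where "S = Pi UNIV (\<lambda>_::'n. {..<CARD('p) ^ N})"
  have fin: "finite S" unfolding S_def by (intro finite_Pi_UNIV) simp
  have "padic_norm (?R M x) \<le> e / 2"
    if M: "finite M" "S \<subseteq> M" and x: "x \<in> padic_ints_vec" for M x
  proof -
    let ?y = "\<lambda>i. padic_trunc N (x $ i)"
    have "parts_box CARD('p) ?y \<subseteq> S"
      unfolding S_def using padic_trunc(1)[OF padic_ints_vec_nth[OF x]]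
      by (intro Pi_mono) (auto dest!: initial_parts_le intro: le_less_trans)
    \<comment> \<open>On indices in \<open>S\<close> the basis functions at \<open>x\<close> are the
      indicator of the box of the truncated point, which lies inside \<open>S\<close>.\<close>
    then have "(\<Sum>m\<in>S. A m * vdp_prod m x) = (\<Sum>m\<in>parts_box CARD('p) ?y. A m)"
      using fin x N by (intro sum.mono_neutral_cong_right) (auto simp: S_def vdp_prod_eq_box[of x N] Pi_iff)
    also have "\<dots> = F (\<chi> i. of_nat (?y i))" by (rule A)
    finally have "(\<Sum>m\<in>M. A m * vdp_prod m x) =
        F (\<chi> i. of_nat (?y i)) + (\<Sum>m\<in>M - S. A m * vdp_prod m x)"
      using sum.subset_diff[OF M(2) M(1), of "\<lambda>m. A m * vdp_prod m x"] by (simp add: add.commute)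
    then have "?R M x = (F x - F (\<chi> i. of_nat (?y i))) - (\<Sum>m\<in>M - S. A m * vdp_prod m x)"
      by simp
    also have "padic_norm \<dots> \<le> e / 2"
    proof (rule padic_norm_diff_le)
      show "padic_norm (F x - F (\<chi> i. of_nat (?y i))) \<le> e / 2"
        using x padic_trunc(2)[OF padic_ints_vec_nth[OF x]] by (intro unif) auto
      have "padic_norm (A m) \<le> e / 2" if "m \<in> M - S" for m
      proof -
        obtain i where i: "m i \<ge> CARD('p) ^ N" using \<open>m \<in> M - S\<close> by (auto simp: S_def Pi_iff not_less)
        show ?thesis by (rule padic_norm_coeff_small, fact A, fact N, fact unif, fact i)
      qed
      then show "padic_norm (\<Sum>m\<in>M - S. A m * vdp_prod m x) \<le> e / 2"
        using e by (intro padic_norm_sum_le order.trans[OF padic_norm_mult_vdp_prod_le]) auto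
    qed
    finally show ?thesis .
  qed
  \<comment> \<open>Passing to the supremum keeps only a weak bound, hence the \<open>e / 2\<close>
    above.\<close>
  then have "dist (sup_norm (?R M)) 0 < e" if "finite M" "S \<subseteq> M" for M
    using that e sup_norm_le[of "?R M" "e / 2"] sup_norm_nonneg[of "?R M" "e / 2"] by force
  then show "\<forall>\<^sub>F M in finite_subsets_at_top UNIV. dist (sup_norm (?R M)) 0 < e"
    unfolding eventually_finite_subsets_at_top using fin by blast
qed

text \<open>The value is within \<open>e\<close> of a finite partial sum, which the ultrametric
  inequality bounds by the supremum of the coefficients.\<close>

lemma padic_norm_le_SUP_coeff:
  fixes F :: "'p::prime_card padic ^ 'n::finite \<Rightarrow> 'p padic"
  assumes F: "F \<in> cont_fun" and A: "expansion vdp_prod A F"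
    and bdd: "bdd_above (range (\<lambda>m. padic_norm (A m)))" and x: "x \<in> padic_ints_vec"
  shows "padic_norm (F x) \<le> (SUP m. padic_norm (A m))"
proof (rule field_le_epsilon)
  fix e :: real assume e: "e > 0"
  let ?s = "SUP m. padic_norm (A m)"
  have s: "padic_norm (A m) \<le> ?s" for m using bdd by (intro cSUP_upper) auto
  then have s0: "?s \<ge> 0" using padic_norm_nonneg[of "A (\<lambda>_. 0)"] order.trans by blast
  have "((\<lambda>M. \<Sum>m\<in>M. A m * vdp_prod m x) \<longlongrightarrow> F x) (finite_subsets_at_top UNIV)"
    using expansion_imp_has_sum[OF F A x] by (simp add: has_sum_def)
  from eventually_happens[OF tendstoD[OF this e]] obtain M
    where M: "dist (\<Sum>m\<in>M. A m * vdp_prod m x) (F x) < e"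
    by auto
  have 1: "padic_norm (F x - (\<Sum>m\<in>M. A m * vdp_prod m x)) \<le> ?s + e"
    using M s0 by (subst padic_norm_minus_commute) (simp add: dist_padic_def)
  have 2: "padic_norm (\<Sum>m\<in>M. A m * vdp_prod m x) \<le> ?s + e"
    using s0 e by (intro padic_norm_sum_le order.trans[OF padic_norm_mult_vdp_prod_le] order.trans[OF s]) auto
  show "padic_norm (F x) \<le> ?s + e" using padic_norm_add_le[OF 1 2] by simp
qed

text \<open>Existence comes from the recursive coefficients, uniqueness from the formula expressing
  each coefficient through \<open>F\<close>. The norm identity combines the bound on iterated
  differences with the bound on partial sums.\<close>

lemma vdp_prod_orthonormal_basis:
  "orthonormal_basis (vdp_prod :: ('n::finite \<Rightarrow> nat) \<Rightarrow> 'p::prime_card padic ^ 'n \<Rightarrow> 'p padic)"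
  unfolding orthonormal_basis_def
proof (intro conjI ballI allI vdp_prod_cont)
  fix F :: "'p padic ^ 'n \<Rightarrow> 'p padic"
  assume F: "F \<in> cont_fun"
  have p: "CARD('p) \<ge> 2" using prime_ge_2_nat[OF prime_card[where 'a = 'p]] .
  have box: "(\<Sum>q\<in>parts_box CARD('p) y. A q) = F (\<chi> i. of_nat (y i))" if "expansion vdp_prod A F" for A y
    using sum_box_eq_if_has_sum[of A F] expansion_imp_has_sum[OF F that] by blast
  show "\<exists>!A. expansion vdp_prod A F"
  proof (rule ex_ex1I)
    show "\<exists>A. expansion vdp_prod A F"
      using expansion_if_sum_box[OF F sum_vdp_coeff[OF p]] by blast
    fix A B assume AB: "expansion vdp_prod A F" "expansion vdp_prod B F"
    show "A = B"
    proof
      fix m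
      obtain idx :: "nat \<Rightarrow> 'n" and k where "bij_betw idx {1..k} {i. m i \<ge> CARD('p)}"
        by (rule bij_betw_nat_exists[of "{i. m i \<ge> CARD('p)}"]) auto
      then show "A m = B m"
        using coeff_eq_iter_diff[of A F, OF box[OF AB(1)]] coeff_eq_iter_diff[of B F, OF box[OF AB(2)]]
        by metis
    qed
  qed
  fix A :: "('n \<Rightarrow> nat) \<Rightarrow> 'p padic"
  show "expansion vdp_prod A F \<longrightarrow>
      bdd_above (range (\<lambda>m. padic_norm (A m))) \<and> sup_norm F = (SUP m. padic_norm (A m))"
  proof (intro impI conjI antisym)
    assume A: "expansion vdp_prod A F"
    have le: "padic_norm (A m) \<le> sup_norm F" for m
      by (rule padic_norm_coeff_le[OF box[OF A] F])
    then show bdd: "bdd_above (range (\<lambda>m. padic_norm (A m)))"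
      by (intro bdd_aboveI[of _ "sup_norm F"]) auto
    show "sup_norm F \<le> (SUP m. padic_norm (A m))"
      by (intro sup_norm_le padic_norm_le_SUP_coeff[OF F A bdd])
    show "(SUP m. padic_norm (A m)) \<le> sup_norm F"
      using le by (intro cSUP_least) auto
  qed
qed

theorem theorem3p1:
  shows "orthonormal_basis
           (vdp_prod :: ('n::finite \<Rightarrow> nat) \<Rightarrow> 'p::prime_card padic ^ 'n \<Rightarrow> 'p padic) \<and>
         (\<forall>(F :: 'p padic ^ 'n \<Rightarrow> 'p padic) A.
            continuous_on padic_ints_vec F \<longrightarrow>
            (\<forall>x\<in>padic_ints_vec. ((\<lambda>m. A m * vdp_prod m x) has_sum F x) UNIV) \<longrightarrow>
            (\<forall>m. ((\<forall>i. m i < CARD('p)) \<longrightarrow> A m = F (\<chi> i. of_nat (m i))) \<and>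
                 (\<forall>k idx. k \<ge> 1 \<longrightarrow> bij_betw idx {1..k} {i. m i \<ge> CARD('p)} \<longrightarrow>
                    A m = iter_diff F m idx k m)))"
proof (intro conjI allI impI vdp_prod_orthonormal_basis)
  fix F :: "'p padic ^ 'n \<Rightarrow> 'p padic" and A and m :: "'n \<Rightarrow> nat"
  assume A: "\<forall>x\<in>padic_ints_vec. ((\<lambda>m. A m * vdp_prod m x) has_sum F x) UNIV"
  \<comment> \<open>Pointwise summation at natural points already yields the box equations.\<close>
  note coeff = coeff_eq_iter_diff[of A F, OF sum_box_eq_if_has_sum[OF A]]
  {
    assume "\<forall>i. m i < CARD('p)"
    \<comment> \<open>No entry reaches p, so the empty enumeration applies and the iterated
      difference of level 0 is the value of \<open>F\<close> itself.\<close>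
    then have "bij_betw (\<lambda>_. undefined) {1..0::nat} {i. m i \<ge> CARD('p)}"
      by (simp add: bij_betw_def not_le)
    from coeff[OF this] show "A m = F (\<chi> i. of_nat (m i))" by simp
  next
    fix k :: nat and idx :: "nat \<Rightarrow> 'n"
    assume "bij_betw idx {1..k} {i. m i \<ge> CARD('p)}"
    then show "A m = iter_diff F m idx k m" by (rule coeff)
  }
qed

end
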